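(* Let $\mathcal B=\mathrm{AC}$ and let $>$ be an AC-compatible reduction order used by both $\mathcal I_A$ and $\mathcal{KB}_{\mathrm{AC}}$. For every fair run $(\mathcal E,\varnothing)\vdash^*_{\mathcal I_A}(\varnothing,\mathcal R)$ there exists a run $(\mathcal E,\varnothing)\vdash^*_{\mathcal{KB}_{\mathrm{AC}}}(\varnothing,\mathcal R')$ such that $\mathcal R'/\mathrm{AC}$ is an AC-complete presentation of $\mathcal E$, i.e. $\mathcal R'$ is terminating modulo AC, $\leftrightarrow^*_{\mathcal E\cup\mathrm{AC}}=\leftrightarrow^*_{\mathcal R'\cup\mathrm{AC}}$, and $\leftrightarrow^*_{\mathcal R'\cup\mathrm{AC}}\subseteq\to^*_{\mathcal R'/\mathrm{AC}}\cdot\sim_{\mathrm{AC}}\cdot\leftarrow^*_{\mathcal R'/\mathrm{AC}}$.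
   Context: Terms over a signature $\mathcal F$ with a set of binary AC symbols; $\mathrm{AC}$ is the ES $\{f(x,y)\approx f(y,x),\ f(f(x,y),z)\approx f(x,f(y,z))\mid f\text{ an AC symbol}\}$. For a set $\mathcal E$ of pairs of terms (equations and rules read as oriented pairs), $s\to_{\mathcal E}t$ iff $s|_p=\ell\sigma$, $t=s[r\sigma]_p$ for some $(\ell,r)\in\mathcal E$, position $p$, substitution $\sigma$; $\leftarrow$ is the inverse, $\leftrightarrow$ the symmetric closure. With $\mathcal B$ a fixed ES satisfying $\mathrm{Var}(\ell)=\mathrm{Var}(r)$ for its equations (here $\mathcal B=\mathrm{AC}$): $\sim_{\mathcal B}=\leftrightarrow^*_{\mathcal B}$, $\mathcal B^\pm=\mathcal B\cup\{t\approx s\mid s\approx t\in\mathcal B\}$, $\to_{\mathcal R/\mathcal B}=\sim_{\mathcal B}\cdot\to_{\mathcal R}\cdot\sim_{\mathcal B}$, $s\downarrow^\sim_{\mathcal R}t$ iff $s\to^*_{\mathcal R}\cdot\sim_{\mathcal B}\cdot\leftarrow^*_{\mathcal R}t$; terminating modulo $\mathcal B$: no infinite $\to_{\mathcal R/\mathcal B}$-sequence. A $\mathcal B$-compatible reduction order is a well-founded order on terms closed under contexts and substitutions with $\sim_{\mathcal B}\cdot>\cdot\sim_{\mathcal B}\subseteq>$. Inference system $\mathcal I_A$ (parameterized by $>$) on pairs $(\mathcal E,\mathcal R)$ ($\uplus$ disjoint union, $s\approx^\pm t$ means $s\approx t$ or $t\approx s$): Deduce (peak): $(\mathcal E,\mathcal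 R)\vdash(\mathcal E\cup\{s\approx t\},\mathcal R)$ if $s\leftarrow_{\mathcal R}\cdot\to_{\mathcal R}t$. Deduce (cliff): $(\mathcal E,\mathcal R)\vdash(\mathcal E,\mathcal R\cup\{t\to s\})$ if $s\leftarrow_{\mathcal R}\cdot\leftrightarrow_{\mathcal B}t$. Orient: $(\mathcal E\uplus\{s\approx^\pm t\},\mathcal R)\vdash(\mathcal E,\mathcal R\cup\{s\to t\})$ if $s>t$. Delete: $(\mathcal E\uplus\{s\approx t\},\mathcal R)\vdash(\mathcal E,\mathcal R)$ if $s\sim_{\mathcal B}t$. Simplify: $(\mathcal E\uplus\{s\approx^\pm t\},\mathcal R)\vdash(\mathcal E\cup\{u\approx t\},\mathcal R)$ if $s\to_{\mathcal R/\mathcal B}u$. Collapse: $(\mathcal E,\mathcal R\uplus\{s\to t\})\vdash(\mathcal E\cup\{u\approx t\},\mathcal R)$ if $s\to_{\mathcal R}u$. Compose: $(\mathcal E,\mathcal R\uplus\{s\to t\})\vdash(\mathcal E,\mathcal R\cup\{s\to u\})$ if $t\to_{\mathcal R/\mathcal B}u$. The inference system $\mathcal{KB}_{\mathrm{AC}}$ is $\mathcal I_A$ with $\mathcal B=\mathrm{AC}$, except that Collapse may rewrite with $\to_{\mathcal R/\mathrm{AC}}$ (condition $s\to_{\mathcal R/\mathrm{AC}}u$), and the two Deduce rules are replaced by: $(\mathcal E,\mathcal R)\vdash(\mathcal E\cup\{s\approx t\},\mathcal R)$ if $s\leftarrow_{\mathcal R}\cdot\sim_{\mathrm{AC}}\cdot\to_{\mathcal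 R}t$. An $\mathcal I_A$-run for $\mathcal E$ goes from $(\mathcal E_0,\mathcal R_0)=(\mathcal E,\varnothing)$ to $(\mathcal E_n,\mathcal R_n)$; it is fair if $\mathcal R_n$ is left-linear, $\mathrm{PCP}(\mathcal R_n)\subseteq\ \downarrow^\sim_{\mathcal R_n}\cup\bigcup_{i=0}^n\leftrightarrow_{\mathcal E_i\cup\mathcal R_i}$ and $\mathrm{PCP}^\pm(\mathcal R_n,\mathcal B^\pm)\subseteq\ \downarrow^\sim_{\mathcal R_n}\cup\bigcup_{i=0}^n\leftrightarrow_{\mathcal R_i}$. Critical pairs: for sets of oriented pairs $\mathcal R_1,\mathcal R_2$, an overlap is $\langle\ell_1\to r_1,p,\ell_2\to r_2\rangle$ with $\ell_i\to r_i$ variants of elements of $\mathcal R_i$ without common variables, $p$ a non-variable position of $\ell_2$, $\ell_1,\ell_2|_p$ unifiable, rules not variants if $p=\epsilon$; with mgu $\sigma$ it yields the critical pair $\ell_2\sigma[r_1\sigma]_p\approx r_2\sigma$, prime if all proper subterms of $\ell_2\sigma|_p$ are normal forms w.r.t. the TRS under consideration. $\mathrm{PCP}(\mathcal R)$: prime critical pairs of $\mathcal R$ with itself; $\mathrm{PCP}^\pm(\mathcal R,\mathcal B^\pm)$: prime critical pairs between $\mathcal R$ and $\mathcal B^\pm$ in either order. *)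

theory Defs
  imports Main
begin

datatype ('f, 'v) "term" = Var 'v | Fun 'f "('f, 'v) term list"

type_synonym ('f, 'v) rule = "('f, 'v) term \<times> ('f, 'v) term"
type_synonym ('f, 'v) trs = "('f, 'v) rule set"
type_synonym pos = "nat list"

fun subst :: "('v \<Rightarrow> ('f, 'v) term) \<Rightarrow> ('f, 'v) term \<Rightarrow> ('f, 'v) term" where
  "subst \<sigma> (Var x) = \<sigma> x"
| "subst \<sigma> (Fun f ts) = Fun f (map (subst \<sigma>) ts)"

definition subst_comp ::
  "('v \<Rightarrow> ('f, 'v) term) \<Rightarrow> ('v \<Rightarrow> ('f, 'v) term) \<Rightarrow> ('v \<Rightarrow> ('f, 'v) term)" where
  "subst_comp \<sigma> \<tau> = (\<lambda>x. subst \<tau> (\<sigma> x))"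

fun vars_list :: "('f, 'v) term \<Rightarrow> 'v list" where
  "vars_list (Var x) = [x]"
| "vars_list (Fun f ts) = concat (map vars_list ts)"

definition linear_term :: "('f, 'v) term \<Rightarrow> bool" where
  "linear_term t = distinct (vars_list t)"

definition left_linear :: "('f, 'v) trs \<Rightarrow> bool" where
  "left_linear R = (\<forall>(l, r) \<in> R. linear_term l)"

function poss :: "('f, 'v) term \<Rightarrow> pos set" where
  "poss (Var x) = {[]}"
| "poss (Fun f ts) = insert [] (\<Union>i \<in> {..<length ts}. (#) i ` poss (ts ! i))"
  by pat_completeness auto
termination
  by (relation "measure size") (auto simp: elim!: nth_mem[THEN size_list_estimation', rotated] intro: less_Suc_eq_le[THEN iffD2] size_list_estimation' nth_mem)

fun subt_at :: "('f, 'v) term \<Rightarrow> pos \<Rightarrow> ('f, 'v) term" where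
  "subt_at t [] = t"
| "subt_at (Fun f ts) (i # p) = subt_at (ts ! i) p"
| "subt_at (Var x) (i # p) = Var x"

fun replace_at :: "('f, 'v) term \<Rightarrow> pos \<Rightarrow> ('f, 'v) term \<Rightarrow> ('f, 'v) term" where
  "replace_at t [] s = s"
| "replace_at (Fun f ts) (i # p) s = Fun f (ts[i := replace_at (ts ! i) p s])"
| "replace_at (Var x) (i # p) s = Var x"

definition is_Fun :: "('f, 'v) term \<Rightarrow> bool" where
  "is_Fun t = (\<exists>f ts. t = Fun f ts)"

definition fun_poss :: "('f, 'v) term \<Rightarrow> pos set" where
  "fun_poss t = {p \<in> poss t. is_Fun (subt_at t p)}"

definition rstep :: "('f, 'v) trs \<Rightarrow> ('f, 'v) term rel" where
  "rstep R = {(s, t). \<exists>l r p \<sigma>. (l, r) \<in> R \<and> p \<in> poss s \<and>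
      subt_at s p = subst \<sigma> l \<and> t = replace_at s p (subst \<sigma> r)}"

definition sstep :: "('f, 'v) trs \<Rightarrow> ('f, 'v) term rel" where
  "sstep E = rstep E \<union> (rstep E)\<inverse>"

definition conv :: "('f, 'v) trs \<Rightarrow> ('f, 'v) term rel" where
  "conv E = (sstep E)\<^sup>*"

definition relmod :: "('f, 'v) trs \<Rightarrow> ('f, 'v) trs \<Rightarrow> ('f, 'v) term rel" where
  "relmod R B = conv B O rstep R O conv B"

definition join_mod :: "('f, 'v) trs \<Rightarrow> ('f, 'v) trs \<Rightarrow> ('f, 'v) term rel" where
  "join_mod R B = (rstep R)\<^sup>* O conv B O ((rstep R)\<inverse>)\<^sup>*"

definition SN_rel :: "'a rel \<Rightarrow> bool" where
  "SN_rel r = (\<not> (\<exists>f. \<forall>i. (f i, f (Suc i)) \<in> r))"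

definition NF :: "('f, 'v) trs \<Rightarrow> ('f, 'v) term \<Rightarrow> bool" where
  "NF R t = (\<nexists>u. (t, u) \<in> rstep R)"

text \<open>The equational system AC for the set \<open>F\<close> of binary AC symbols
  (all variants of the commutativity and associativity equations).\<close>
definition AC :: "'f set \<Rightarrow> ('f, 'v) trs" where
  "AC F = {(l, r). \<exists>f \<in> F. \<exists>x y z. distinct [x, y, z] \<and>
      ((l = Fun f [Var x, Var y] \<and> r = Fun f [Var y, Var x]) \<or>
       (l = Fun f [Fun f [Var x, Var y], Var z] \<and> r = Fun f [Var x, Fun f [Var y, Var z]]))}"

definition pm :: "('f, 'v) trs \<Rightarrow> ('f, 'v) trs" where
  "pm B = B \<union> B\<inverse>"

text \<open>\<open>B\<close>-compatible reduction order (strict order given as a relation \<open>gt\<close>,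
  \<open>(s, t) \<in> gt\<close> meaning \<open>s > t\<close>).\<close>
definition reduction_order_mod :: "('f, 'v) trs \<Rightarrow> ('f, 'v) term rel \<Rightarrow> bool" where
  "reduction_order_mod B gt \<longleftrightarrow>
     irrefl gt \<and> trans gt \<and> wf (gt\<inverse>) \<and>
     (\<forall>s t u p. (s, t) \<in> gt \<and> p \<in> poss u \<longrightarrow> (replace_at u p s, replace_at u p t) \<in> gt) \<and>
     (\<forall>s t \<sigma>. (s, t) \<in> gt \<longrightarrow> (subst \<sigma> s, subst \<sigma> t) \<in> gt) \<and>
     conv B O gt O conv B \<subseteq> gt"

definition renaming :: "('v \<Rightarrow> 'v) \<Rightarrow> bool" where
  "renaming \<pi> = bij \<pi>"

definition variant :: "('f, 'v) rule \<Rightarrow> ('f, 'v) rule \<Rightarrow> bool" where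
  "variant lr' lr \<longleftrightarrow> (\<exists>\<pi>. renaming \<pi> \<and>
      fst lr' = subst (Var \<circ> \<pi>) (fst lr) \<and> snd lr' = subst (Var \<circ> \<pi>) (snd lr))"

definition rule_vars :: "('f, 'v) rule \<Rightarrow> 'v set" where
  "rule_vars lr = set (vars_list (fst lr)) \<union> set (vars_list (snd lr))"

definition is_mgu :: "('v \<Rightarrow> ('f, 'v) term) \<Rightarrow> ('f, 'v) term \<Rightarrow> ('f, 'v) term \<Rightarrow> bool" where
  "is_mgu \<sigma> s t \<longleftrightarrow> subst \<sigma> s = subst \<sigma> t \<and>
     (\<forall>\<tau>. subst \<tau> s = subst \<tau> t \<longrightarrow> (\<exists>\<delta>. \<tau> = subst_comp \<sigma> \<delta>))"

definition overlap :: "('f, 'v) trs \<Rightarrow> ('f, 'v) trs \<Rightarrow> ('f, 'v) rule \<Rightarrow> pos \<Rightarrow> ('f, 'v) rule \<Rightarrow> bool" where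
  "overlap R1 R2 lr1 p lr2 \<longleftrightarrow>
     (\<exists>lr \<in> R1. variant lr1 lr) \<and> (\<exists>lr \<in> R2. variant lr2 lr) \<and>
     rule_vars lr1 \<inter> rule_vars lr2 = {} \<and>
     p \<in> fun_poss (fst lr2) \<and>
     (\<exists>\<sigma>. subst \<sigma> (fst lr1) = subst \<sigma> (subt_at (fst lr2) p)) \<and>
     (p = [] \<longrightarrow> \<not> variant lr1 lr2)"

text \<open>Prime critical pairs between \<open>R1\<close> and \<open>R2\<close>, primality being
  w.r.t. the TRS \<open>S\<close> under consideration.\<close>
definition PCP2 :: "('f, 'v) trs \<Rightarrow> ('f, 'v) trs \<Rightarrow> ('f, 'v) trs \<Rightarrow> ('f, 'v) term rel" where
  "PCP2 S R1 R2 = {(s, t). \<exists>l1 r1 p l2 r2 \<sigma>.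
      overlap R1 R2 (l1, r1) p (l2, r2) \<and> is_mgu \<sigma> l1 (subt_at l2 p) \<and>
      s = replace_at (subst \<sigma> l2) p (subst \<sigma> r1) \<and> t = subst \<sigma> r2 \<and>
      (\<forall>q \<in> poss (subt_at (subst \<sigma> l2) p). q \<noteq> [] \<longrightarrow>
          NF S (subt_at (subt_at (subst \<sigma> l2) p) q))}"

definition PCP :: "('f, 'v) trs \<Rightarrow> ('f, 'v) term rel" where
  "PCP R = PCP2 R R R"

definition PCPpm :: "('f, 'v) trs \<Rightarrow> ('f, 'v) trs \<Rightarrow> ('f, 'v) term rel" where
  "PCPpm R B = PCP2 R R B \<union> PCP2 R B R"

type_synonym ('f, 'v) state = "('f, 'v) trs \<times> ('f, 'v) trs"

inductive IA_step :: "('f, 'v) trs \<Rightarrow> ('f, 'v) term rel \<Rightarrow> ('f, 'v) state \<Rightarrow> ('f, 'v) state \<Rightarrow> bool"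
  for B gt where
  deduce_peak: "(s, t) \<in> (rstep R)\<inverse> O rstep R \<Longrightarrow>
     IA_step B gt (E, R) (E \<union> {(s, t)}, R)"
| deduce_cliff: "(s, t) \<in> (rstep R)\<inverse> O sstep B \<Longrightarrow>
     IA_step B gt (E, R) (E, R \<union> {(t, s)})"
| orient: "e \<in> E \<Longrightarrow> e = (s, t) \<or> e = (t, s) \<Longrightarrow> (s, t) \<in> gt \<Longrightarrow>
     IA_step B gt (E, R) (E - {e}, R \<union> {(s, t)})"
| delete: "(s, t) \<in> E \<Longrightarrow> (s, t) \<in> conv B \<Longrightarrow>
     IA_step B gt (E, R) (E - {(s, t)}, R)"
| simplify: "e \<in> E \<Longrightarrow> e = (s, t) \<or> e = (t, s) \<Longrightarrow> (s, u) \<in> relmod R B \<Longrightarrow>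
     IA_step B gt (E, R) ((E - {e}) \<union> {(u, t)}, R)"
| collapse: "(s, t) \<in> R \<Longrightarrow> (s, u) \<in> rstep (R - {(s, t)}) \<Longrightarrow>
     IA_step B gt (E, R) (E \<union> {(u, t)}, R - {(s, t)})"
| compose: "(s, t) \<in> R \<Longrightarrow> (t, u) \<in> relmod (R - {(s, t)}) B \<Longrightarrow>
     IA_step B gt (E, R) (E, (R - {(s, t)}) \<union> {(s, u)})"

inductive KBAC_step :: "'f set \<Rightarrow> ('f, 'v) term rel \<Rightarrow> ('f, 'v) state \<Rightarrow> ('f, 'v) state \<Rightarrow> bool"
  for F gt where
  deduce: "(s, t) \<in> (rstep R)\<inverse> O conv (AC F) O rstep R \<Longrightarrow>
     KBAC_step F gt (E, R) (E \<union> {(s, t)}, R)"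
| orient: "e \<in> E \<Longrightarrow> e = (s, t) \<or> e = (t, s) \<Longrightarrow> (s, t) \<in> gt \<Longrightarrow>
     KBAC_step F gt (E, R) (E - {e}, R \<union> {(s, t)})"
| delete: "(s, t) \<in> E \<Longrightarrow> (s, t) \<in> conv (AC F) \<Longrightarrow>
     KBAC_step F gt (E, R) (E - {(s, t)}, R)"
| simplify: "e \<in> E \<Longrightarrow> e = (s, t) \<or> e = (t, s) \<Longrightarrow> (s, u) \<in> relmod R (AC F) \<Longrightarrow>
     KBAC_step F gt (E, R) ((E - {e}) \<union> {(u, t)}, R)"
| collapse: "(s, t) \<in> R \<Longrightarrow> (s, u) \<in> relmod (R - {(s, t)}) (AC F) \<Longrightarrow>
     KBAC_step F gt (E, R) (E \<union> {(u, t)}, R - {(s, t)})"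
| compose: "(s, t) \<in> R \<Longrightarrow> (t, u) \<in> relmod (R - {(s, t)}) (AC F) \<Longrightarrow>
     KBAC_step F gt (E, R) (E, (R - {(s, t)}) \<union> {(s, u)})"

definition run :: "(('f, 'v) state \<Rightarrow> ('f, 'v) state \<Rightarrow> bool) \<Rightarrow> ('f, 'v) trs \<Rightarrow>
    (nat \<Rightarrow> ('f, 'v) state) \<Rightarrow> nat \<Rightarrow> bool" where
  "run step E S n \<longleftrightarrow> S 0 = (E, {}) \<and> (\<forall>i < n. step (S i) (S (Suc i)))"

definition fair_run :: "('f, 'v) trs \<Rightarrow> (nat \<Rightarrow> ('f, 'v) state) \<Rightarrow> nat \<Rightarrow> bool" where
  "fair_run B S n \<longleftrightarrow>
     (let Rn = snd (S n) in
       left_linear Rn \<and>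
       PCP Rn \<subseteq> join_mod Rn B \<union> (\<Union>i \<le> n. sstep (fst (S i) \<union> snd (S i))) \<and>
       PCPpm Rn (pm B) \<subseteq> join_mod Rn B \<union> (\<Union>i \<le> n. sstep (snd (S i))))"

end

theory Submission
  imports Defs "HOL-Library.Sublist"
begin

text \<open>
  Let \<open>R\<close> be the final system of the fair run. Going backwards through the run, every equation
  that ever occurred is replaced by a conversion over \<open>R\<close> and AC bounded by its two sides, and
  every rule \<open>l \<rightarrow> r\<close> by an \<open>R\<close>-step from \<open>l\<close> followed by a conversion strictly below \<open>l\<close>. With
  fairness this makes every local peak \<open>s \<leftarrow> u \<rightarrow> t\<close> convertible strictly below \<open>u\<close>, and provides
  for every local cliff \<open>s \<leftarrow> u \<leftrightarrow> t\<close> a step \<open>t \<rightarrow> t'\<close> with \<open>t'\<close> and \<open>s\<close> convertible strictly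
  below \<open>u\<close>. Well-founded induction then shows that AC-equivalent terms have AC-equivalent
  \<open>R\<close>-normal forms, whence \<open>R\<close> is Church-Rosser modulo AC. Of AC itself only the linearity of its
  equations matters here.

  The AC completion run keeps all its rules forever and imitates only orientations and
  simplifications. All other rules and equations of the original run are reachable from these by
  rewriting modulo AC, so the resulting system simulates \<open>R\<close> and inherits the Church-Rosser
  property. Surplus equations are valid, hence joinable in the end, and can be simplified and
  deleted.
\<close>

section \<open>Church-Rosser modulo an equivalence\<close>

lemma rtrancl_map:
  assumes "(x, y) \<in> r\<^sup>*" "\<And>x y. (x, y) \<in> r \<Longrightarrow> (f x, f y) \<in> r'"
  shows "(f x, f y) \<in> r'\<^sup>*"
  using assms(1) by (induction rule: rtrancl_induct) (auto intro: rtrancl_into_rtrancl assms(2))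

definition conv_within :: "'a rel \<Rightarrow> 'a set \<Rightarrow> 'a rel" where
  "conv_within r W = {(x, y). (x, y) \<in> r \<and> x \<in> W \<and> y \<in> W}\<^sup>*"

lemma conv_within_refl [simp]: "(x, x) \<in> conv_within r W"
  by (simp add: conv_within_def)

lemma conv_within_step: "(x, y) \<in> r \<Longrightarrow> x \<in> W \<Longrightarrow> y \<in> W \<Longrightarrow> (x, y) \<in> conv_within r W"
  by (auto simp: conv_within_def)

lemma conv_within_trans [trans]:
  "(x, y) \<in> conv_within r W \<Longrightarrow> (y, z) \<in> conv_within r W \<Longrightarrow> (x, z) \<in> conv_within r W"
  by (auto simp: conv_within_def)

lemma conv_within_sym:
  assumes "sym r" "(x, y) \<in> conv_within r W"
  shows "(y, x) \<in> conv_within r W"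
proof -
  have "sym {(x, y). (x, y) \<in> r \<and> x \<in> W \<and> y \<in> W}" using assms(1) by (auto simp: sym_def)
  then show ?thesis using assms(2) unfolding conv_within_def by (rule symD[OF sym_rtrancl])
qed

lemma conv_within_mono: "W \<subseteq> W' \<Longrightarrow> (x, y) \<in> conv_within r W \<Longrightarrow> (x, y) \<in> conv_within r W'"
  unfolding conv_within_def by (rule subsetD[OF rtrancl_mono]) auto

lemma conv_within_closed: "(x, y) \<in> conv_within r W \<Longrightarrow> x \<in> W \<Longrightarrow> y \<in> W"
  unfolding conv_within_def by (induction rule: rtrancl_induct) auto

lemma conv_within_UNIV: "conv_within r UNIV = r\<^sup>*"
  by (simp add: conv_within_def)

lemma conv_within_map:
  assumes "(x, y) \<in> conv_within r {x. f x \<in> W}" "\<And>x y. (x, y) \<in> r \<Longrightarrow> (f x, f y) \<in> r"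
  shows "(f x, f y) \<in> conv_within r W"
  using assms(1) unfolding conv_within_def by (rule rtrancl_map) (auto intro: assms(2))

definition normal_form_of :: "'a rel \<Rightarrow> 'a \<Rightarrow> 'a \<Rightarrow> bool" where
  "normal_form_of r x y \<longleftrightarrow> (x, y) \<in> r\<^sup>* \<and> y \<notin> Domain r"

lemma normal_form_of_step: "(x, y) \<in> r \<Longrightarrow> normal_form_of r y z \<Longrightarrow> normal_form_of r x z"
  by (auto simp: normal_form_of_def intro: converse_rtrancl_into_rtrancl)

lemma normal_form_of_irreducible: "x \<notin> Domain r \<Longrightarrow> normal_form_of r x z \<longleftrightarrow> z = x"
  unfolding normal_form_of_def by (metis Domain.DomainI converse_rtranclE rtrancl.rtrancl_refl)

lemma normal_form_of_reducibleE:
  assumes "normal_form_of r x z" "x \<in> Domain r"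
  obtains y where "(x, y) \<in> r" "normal_form_of r y z"
  using assms unfolding normal_form_of_def by (metis converse_rtranclE)

locale locally_decreasing_modulo =
  fixes r b gt :: "'a rel"
  assumes wf_gt: "wf (gt\<inverse>)" and step_gt: "r \<subseteq> gt" and sym_b: "sym b"
    and compatible: "b\<^sup>* O gt O b\<^sup>* \<subseteq> gt"
    and peak: "(u, s) \<in> r \<Longrightarrow> (u, t) \<in> r \<Longrightarrow>
      (s, t) \<in> conv_within (r \<union> r\<inverse> \<union> b) {x. (u, x) \<in> gt}"
    and cliff: "(u, s) \<in> r \<Longrightarrow> (u, t) \<in> b \<Longrightarrow>
      \<exists>v. (t, v) \<in> r \<and> (v, s) \<in> conv_within (r \<union> r\<inverse> \<union> b) {x. (u, x) \<in> gt}"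
begin

abbreviation convertible_below :: "'a \<Rightarrow> 'a rel" where
  "convertible_below u \<equiv> conv_within (r \<union> r\<inverse> \<union> b) {x. (u, x) \<in> gt}"

definition nf_equiv :: "'a rel" where
  "nf_equiv = {(x, y). \<forall>x' y'. normal_form_of r x x' \<longrightarrow> normal_form_of r y y' \<longrightarrow> (x', y') \<in> b\<^sup>*}"

definition nf_equiv_below :: "'a \<Rightarrow> bool" where
  "nf_equiv_below u \<longleftrightarrow> (\<forall>x y. (u, x) \<in> gt \<longrightarrow> (x, y) \<in> b\<^sup>* \<longrightarrow> (x, y) \<in> nf_equiv)"

lemma b_rtrancl_sym: "(x, y) \<in> b\<^sup>* \<Longrightarrow> (y, x) \<in> b\<^sup>*"
  by (rule symD[OF sym_rtrancl[OF sym_b]])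

lemma gt_modulo: "(u, v) \<in> b\<^sup>* \<Longrightarrow> (v, x) \<in> gt \<Longrightarrow> (u, x) \<in> gt"
  using compatible by blast

lemma nf_equiv_below_modulo: "nf_equiv_below u \<Longrightarrow> (u, v) \<in> b\<^sup>* \<Longrightarrow> nf_equiv_below v"
  unfolding nf_equiv_below_def using gt_modulo by blast

lemma normal_form_exists: "\<exists>y. normal_form_of r x y"
  using wf_gt
proof (induction x rule: wf_induct_rule)
  case (less x)
  show ?case
  proof (cases "x \<in> Domain r")
    case True
    then obtain z where reduct: "(x, z) \<in> r" by blast
    then obtain y where "normal_form_of r z y" using less.IH[of z] step_gt by blast
    with reduct show ?thesis by (blast intro: normal_form_of_step)
  qed (auto simp: normal_form_of_def)
qed

lemma nf_equiv_sym: "(x, y) \<in> nf_equiv \<Longrightarrow> (y, x) \<in> nf_equiv"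
  by (clarsimp simp: nf_equiv_def) (rule b_rtrancl_sym, simp)

lemma nf_equiv_trans [trans]:
  assumes "(x, y) \<in> nf_equiv" "(y, z) \<in> nf_equiv"
  shows "(x, z) \<in> nf_equiv"
proof -
  obtain y' where normal_form: "normal_form_of r y y'" using normal_form_exists by blast
  have "(x', z') \<in> b\<^sup>*" if "normal_form_of r x x'" "normal_form_of r z z'" for x' z'
  proof -
    have "(x', y') \<in> b\<^sup>*" "(y', z') \<in> b\<^sup>*"
      using assms that normal_form by (simp_all add: nf_equiv_def)
    then show ?thesis by (rule rtrancl_trans)
  qed
  then show ?thesis by (simp add: nf_equiv_def)
qed

lemma nf_equiv_step: "(x, x) \<in> nf_equiv \<Longrightarrow> (x, y) \<in> r \<Longrightarrow> (x, y) \<in> nf_equiv"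
  by (simp add: nf_equiv_def normal_form_of_step)

lemma conv_within_nf_equiv:
  assumes "(x, y) \<in> conv_within (r \<union> r\<inverse> \<union> b) W" "x \<in> W"
    and modulo: "\<And>v w. v \<in> W \<Longrightarrow> (v, w) \<in> b\<^sup>* \<Longrightarrow> (v, w) \<in> nf_equiv"
  shows "(x, y) \<in> nf_equiv"
  using assms(1) unfolding conv_within_def
proof (induction rule: rtrancl_induct)
  case base
  then show ?case using modulo[OF assms(2)] by blast
next
  case (step v w)
  then have endpoints: "v \<in> W" "w \<in> W" by auto
  then have refl: "(v, v) \<in> nf_equiv" "(w, w) \<in> nf_equiv" using modulo by auto
  from step.hyps consider (forward) "(v, w) \<in> r" | (backward) "(w, v) \<in> r" | (modulo) "(v, w) \<in> b"
    by auto
  then have "(v, w) \<in> nf_equiv"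
  proof cases
    case forward
    with refl(1) show ?thesis by (rule nf_equiv_step)
  next
    case backward
    with refl(2) show ?thesis by (rule nf_equiv_sym[OF nf_equiv_step])
  next
    case modulo
    then show ?thesis using assms(3) endpoints(1) by blast
  qed
  with step.IH show ?case by (rule nf_equiv_trans)
qed

lemma convertible_below_nf_equiv:
  assumes "(s, t) \<in> convertible_below u" "(u, s) \<in> gt" "nf_equiv_below u"
  shows "(s, t) \<in> nf_equiv"
proof (rule conv_within_nf_equiv[OF assms(1)])
  show "s \<in> {x. (u, x) \<in> gt}" using assms(2) by simp
  show "(v, w) \<in> nf_equiv" if "v \<in> {x. (u, x) \<in> gt}" "(v, w) \<in> b\<^sup>*" for v w
    using that assms(3) unfolding nf_equiv_below_def by blast
qed

lemma nf_equiv_refl: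
  assumes "nf_equiv_below u"
  shows "(u, u) \<in> nf_equiv"
  unfolding nf_equiv_def
proof clarify
  fix x y assume nf_left: "normal_form_of r u x" and nf_right: "normal_form_of r u y"
  show "(x, y) \<in> b\<^sup>*"
  proof (cases "u \<in> Domain r")
    case True
    obtain s where step_left: "(u, s) \<in> r" "normal_form_of r s x"
      using nf_left True by (rule normal_form_of_reducibleE)
    obtain t where step_right: "(u, t) \<in> r" "normal_form_of r t y"
      using nf_right True by (rule normal_form_of_reducibleE)
    have "(s, t) \<in> nf_equiv"
      using peak[OF step_left(1) step_right(1)] step_gt step_left(1) assms
        convertible_below_nf_equiv by blast
    then show ?thesis using step_left(2) step_right(2) by (simp add: nf_equiv_def)
  next
    case False
    then show ?thesis using nf_left nf_right by (simp add: normal_form_of_irreducible)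
  qed
qed

lemma nf_equiv_cliff:
  assumes "(u, s) \<in> r" "(u, v) \<in> b" "nf_equiv_below u"
  shows "(u, v) \<in> nf_equiv"
proof -
  have modulo: "nf_equiv_below v" using assms(2,3) nf_equiv_below_modulo by blast
  obtain t where closing_step: "(v, t) \<in> r" "(t, s) \<in> convertible_below u"
    using cliff assms by blast
  have "(u, t) \<in> gt" using gt_modulo[of u v t] assms(2) closing_step(1) step_gt by blast
  have "(u, s) \<in> nf_equiv" using nf_equiv_refl[OF assms(3)] assms(1) by (rule nf_equiv_step)
  also have "(s, t) \<in> nf_equiv"
    using convertible_below_nf_equiv[OF closing_step(2) \<open>(u, t) \<in> gt\<close> assms(3)]
    by (rule nf_equiv_sym)
  also have "(t, v) \<in> nf_equiv"
    using nf_equiv_step[OF nf_equiv_refl[OF modulo] closing_step(1)] by (rule nf_equiv_sym)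
  finally show ?thesis .
qed

lemma nf_equiv_b_step:
  assumes "(u, v) \<in> b" "nf_equiv_below u"
  shows "(u, v) \<in> nf_equiv"
proof -
  have converse: "(v, u) \<in> b" using sym_b assms(1) by (rule symD)
  have modulo: "nf_equiv_below v" using assms nf_equiv_below_modulo by blast
  consider (source) "u \<in> Domain r" | (target) "v \<in> Domain r"
    | (neither) "u \<notin> Domain r" "v \<notin> Domain r" by blast
  then show ?thesis
  proof cases
    case source
    then obtain s where "(u, s) \<in> r" by blast
    then show ?thesis using assms by (rule nf_equiv_cliff)
  next
    case target
    then obtain s where "(v, s) \<in> r" by blast
    then have "(v, u) \<in> nf_equiv" using converse modulo by (rule nf_equiv_cliff)
    then show ?thesis by (rule nf_equiv_sym)
  next
    case neither
    then show ?thesis using assms(1) by (simp add: nf_equiv_def normal_form_of_irreducible)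
  qed
qed

lemma b_rtrancl_nf_equiv: "(u, v) \<in> b\<^sup>* \<Longrightarrow> (u, v) \<in> nf_equiv"
  using wf_gt
proof (induction u arbitrary: v rule: wf_induct_rule)
  case (less u)
  then have below: "nf_equiv_below u" by (simp add: nf_equiv_below_def)
  from less.prems show ?case
  proof (induction rule: rtrancl_induct)
    case base
    show ?case using below by (rule nf_equiv_refl)
  next
    case (step v w)
    then have "(v, w) \<in> nf_equiv" using below nf_equiv_b_step nf_equiv_below_modulo by blast
    with step.IH show ?case by (rule nf_equiv_trans)
  qed
qed

theorem church_rosser: "(r \<union> r\<inverse> \<union> b)\<^sup>* \<subseteq> r\<^sup>* O b\<^sup>* O (r\<inverse>)\<^sup>*"
proof clarify
  fix s t assume "(s, t) \<in> (r \<union> r\<inverse> \<union> b)\<^sup>*"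
  then have "(s, t) \<in> nf_equiv"
    using conv_within_nf_equiv[of s t UNIV] b_rtrancl_nf_equiv by (simp add: conv_within_UNIV)
  moreover obtain x y where normal_forms: "normal_form_of r s x" "normal_form_of r t y"
    using normal_form_exists by metis
  ultimately have "(x, y) \<in> b\<^sup>*" by (simp add: nf_equiv_def)
  then show "(s, t) \<in> r\<^sup>* O b\<^sup>* O (r\<inverse>)\<^sup>*"
    using normal_forms unfolding normal_form_of_def by (meson relcomp.relcompI rtrancl_converseI)
qed

end

section \<open>Terms, positions and substitutions\<close>

declare poss.simps(2) [simp del]

abbreviation vars :: "('f, 'v) term \<Rightarrow> 'v set" where
  "vars t \<equiv> set (vars_list t)"

lemma Cons_poss_Fun [simp]: "i # p \<in> poss (Fun f ts) \<longleftrightarrow> i < length ts \<and> p \<in> poss (ts ! i)"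
  by (auto simp: poss.simps(2))

lemma Nil_poss [simp]: "[] \<in> poss t"
  by (cases t) (auto simp: poss.simps(2))

lemma poss_append: "p @ q \<in> poss t \<longleftrightarrow> p \<in> poss t \<and> q \<in> poss (subt_at t p)"
  by (induction t p rule: subt_at.induct) auto

lemma subt_at_append: "p \<in> poss t \<Longrightarrow> subt_at t (p @ q) = subt_at (subt_at t p) q"
  by (induction t p rule: subt_at.induct) auto

lemma subt_at_replace_at [simp]: "p \<in> poss t \<Longrightarrow> subt_at (replace_at t p s) p = s"
  by (induction t p rule: subt_at.induct) auto

lemma poss_replace_at [simp]: "p \<in> poss t \<Longrightarrow> p \<in> poss (replace_at t p s)"
  by (induction t p rule: subt_at.induct) auto

lemma replace_at_subt_at [simp]: "p \<in> poss t \<Longrightarrow> replace_at t p (subt_at t p) = t"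
  by (induction t p rule: subt_at.induct) auto

lemma replace_at_replace_at [simp]:
  "p \<in> poss t \<Longrightarrow> replace_at (replace_at t p s) p u = replace_at t p u"
  by (induction t p rule: subt_at.induct) auto

lemma replace_at_append:
  "p \<in> poss t \<Longrightarrow> replace_at t (p @ q) s = replace_at t p (replace_at (subt_at t p) q s)"
  by (induction t p rule: subt_at.induct) auto

lemma size_subt_at: "p \<in> poss t \<Longrightarrow> p \<noteq> [] \<Longrightarrow> size (subt_at t p) < size t"
proof (induction t p rule: subt_at.induct)
  case (2 f ts i p)
  then have "size (ts ! i) < size (Fun f ts)"
    by (auto simp: less_Suc_eq_le intro: size_list_estimation'[OF nth_mem])
  moreover have "size (subt_at (ts ! i) p) \<le> size (ts ! i)"
    using 2 by (cases "p = []") auto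
  ultimately show ?case by simp
qed auto

lemma parallel_poss_replace_at:
  "p \<parallel> q \<Longrightarrow> p \<in> poss t \<Longrightarrow> q \<in> poss t \<Longrightarrow> q \<in> poss (replace_at t p s)"
proof (induction p arbitrary: t q)
  case (Cons i p)
  then show ?case by (cases t; cases q) (auto simp: nth_list_update dest: parallel_cancel)
qed simp

lemma parallel_subt_at_replace_at:
  "p \<parallel> q \<Longrightarrow> p \<in> poss t \<Longrightarrow> q \<in> poss t \<Longrightarrow> subt_at (replace_at t p s) q = subt_at t q"
proof (induction p arbitrary: t q)
  case (Cons i p)
  then show ?case by (cases t; cases q) (auto simp: nth_list_update dest: parallel_cancel)
qed simp

lemma parallel_replace_at_commute:
  "p \<parallel> q \<Longrightarrow> p \<in> poss t \<Longrightarrow> q \<in> poss t \<Longrightarrow>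
    replace_at (replace_at t p s) q u = replace_at (replace_at t q u) p s"
proof (induction p arbitrary: t q)
  case (Cons i p)
  then show ?case
    by (cases t; cases q)
      (auto simp: nth_list_update list_update_swap dest: parallel_cancel)
qed simp

lemma subst_subst: "subst \<tau> (subst \<sigma> t) = subst (subst_comp \<sigma> \<tau>) t"
  by (induction t) (auto simp: subst_comp_def)

lemma subst_comp_assoc:
  "subst_comp (subst_comp \<sigma> \<tau>) \<rho> = subst_comp \<sigma> (subst_comp \<tau> \<rho>)"
  by (simp add: subst_comp_def subst_subst)

lemma subst_Var [simp]: "subst Var t = t"
  by (induction t) (auto simp: map_idI)

lemma subst_eq_iff: "subst \<sigma> t = subst \<tau> t \<longleftrightarrow> (\<forall>x \<in> vars t. \<sigma> x = \<tau> x)"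
  by (induction t) auto

lemma subst_fun_upd_fresh: "x \<notin> vars t \<Longrightarrow> subst (\<sigma>(x := s)) t = subst \<sigma> t"
  by (auto simp: subst_eq_iff)

lemma vars_subst: "vars (subst \<sigma> t) = (\<Union>x \<in> vars t. vars (\<sigma> x))"
  by (induction t) auto

lemma poss_subst [simp]: "p \<in> poss t \<Longrightarrow> p \<in> poss (subst \<sigma> t)"
  by (induction t p rule: subt_at.induct) auto

lemma subt_at_subst [simp]: "p \<in> poss t \<Longrightarrow> subt_at (subst \<sigma> t) p = subst \<sigma> (subt_at t p)"
  by (induction t p rule: subt_at.induct) auto

lemma replace_at_subst:
  "p \<in> poss t \<Longrightarrow> subst \<sigma> (replace_at t p s) = replace_at (subst \<sigma> t) p (subst \<sigma> s)"
  by (induction t p rule: subt_at.induct) (auto simp: map_update)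

lemma vars_subt_at: "p \<in> poss t \<Longrightarrow> vars (subt_at t p) \<subseteq> vars t"
proof (induction t p rule: subt_at.induct)
  case (2 f ts i p)
  then show ?case using nth_mem[of i ts] by fastforce
qed auto

lemma in_vars_iff_subt_at: "x \<in> vars t \<longleftrightarrow> (\<exists>p \<in> poss t. subt_at t p = Var x)"
proof
  show "x \<in> vars t \<Longrightarrow> \<exists>p \<in> poss t. subt_at t p = Var x"
  proof (induction t)
    case (Fun f ts)
    then obtain s where "s \<in> set ts" "x \<in> vars s" by auto
    then obtain i where argument: "i < length ts" "x \<in> vars (ts ! i)" by (metis in_set_conv_nth)
    with Fun.IH obtain p where "p \<in> poss (ts ! i)" "subt_at (ts ! i) p = Var x"
      by (meson nth_mem)
    then show ?case using argument by (intro bexI[of _ "i # p"]) auto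
  qed simp
  show "\<exists>p \<in> poss t. subt_at t p = Var x \<Longrightarrow> x \<in> vars t"
    using vars_subt_at by fastforce
qed

lemma is_Fun_simps [simp]: "is_Fun (Fun f ts)" "\<not> is_Fun (Var x)"
  by (simp_all add: is_Fun_def)

lemma fun_poss_imp_poss: "p \<in> fun_poss t \<Longrightarrow> p \<in> poss t"
  by (simp add: fun_poss_def)

lemma Cons_fun_poss_Fun [simp]:
  "i # p \<in> fun_poss (Fun f ts) \<longleftrightarrow> i < length ts \<and> p \<in> fun_poss (ts ! i)"
  by (auto simp: fun_poss_def)

lemma poss_substE:
  assumes "p \<in> poss (subst \<sigma> t)"
  obtains (symbol) "p \<in> fun_poss t"
  | (variable) q q' x where "p = q @ q'" "q \<in> poss t" "subt_at t q = Var x" "q' \<in> poss (\<sigma> x)"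
proof -
  let ?below_variable = "\<lambda>t p. \<exists>q q' x.
    p = q @ q' \<and> q \<in> poss t \<and> subt_at t q = Var x \<and> q' \<in> poss (\<sigma> x)"
  have "p \<in> fun_poss t \<or> ?below_variable t p"
    using assms
  proof (induction t p rule: subt_at.induct)
    case (1 t)
    then show ?case by (cases t) (auto simp: fun_poss_def)
  next
    case (2 f ts i p)
    then have "i < length ts" "p \<in> fun_poss (ts ! i) \<or> ?below_variable (ts ! i) p" by auto
    moreover have "?below_variable (Fun f ts) (i # p)"
      if "i < length ts" "?below_variable (ts ! i) p"
      using that by (metis Cons_poss_Fun append_Cons subt_at.simps(2))
    ultimately show ?case by auto
  next
    case (3 x i p)
    then show ?case by (auto intro!: exI[of _ "[]"])
  qed
  then show thesis using that by blast
qed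

lemma linear_term_nth: "linear_term (Fun f ts) \<Longrightarrow> i < length ts \<Longrightarrow> linear_term (ts ! i)"
  by (auto simp: linear_term_def distinct_concat_iff)

lemma linear_term_disjoint_args:
  assumes "linear_term (Fun f ts)" "i < j" "j < length ts"
  shows "vars (ts ! i) \<inter> vars (ts ! j) = {}"
proof -
  have "ts = take i ts @ ts ! i # drop (Suc i) ts" using assms by (simp add: id_take_nth_drop)
  then have "distinct (concat (map vars_list (take i ts @ ts ! i # drop (Suc i) ts)))"
    using assms(1) by (simp add: linear_term_def)
  moreover have "ts ! j \<in> set (drop (Suc i) ts)"
    using assms(2,3) by (auto simp: in_set_conv_nth intro!: exI[of _ "j - Suc i"])
  ultimately show ?thesis by auto
qed

lemma replace_at_linear_subst:
  assumes "linear_term t" "p \<in> poss t" "subt_at t p = Var x"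
  shows "replace_at (subst \<sigma> t) (p @ q) s = subst (\<sigma>(x := replace_at (\<sigma> x) q s)) t"
  using assms
proof (induction t p rule: subt_at.induct)
  case (2 f ts i p)
  let ?\<tau> = "\<sigma>(x := replace_at (\<sigma> x) q s)"
  have arg_index: "i < length ts" and var_in_arg: "x \<in> vars (ts ! i)"
    using 2 in_vars_iff_subt_at[of x "ts ! i"] by auto
  have unchanged: "subst \<sigma> (ts ! j) = subst ?\<tau> (ts ! j)" if "j < length ts" "j \<noteq> i" for j
  proof -
    have "vars (ts ! i) \<inter> vars (ts ! j) = {}"
      using linear_term_disjoint_args[OF 2(2)] arg_index that
      by (metis Int_commute linorder_neqE_nat)
    then show ?thesis using var_in_arg by (intro subst_fun_upd_fresh[symmetric]) blast
  qed
  have "replace_at (subst \<sigma> (ts ! i)) (p @ q) s = subst ?\<tau> (ts ! i)"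
    using 2(1)[OF linear_term_nth[OF 2(2) arg_index]] 2(3,4) by (simp del: fun_upd_apply)
  then show ?case
    using arg_index unchanged
    by (auto simp: nth_list_update simp del: fun_upd_apply intro!: nth_equalityI)
qed auto

section \<open>Most general unifiers\<close>

definition unifies :: "('v \<Rightarrow> ('f, 'v) term) \<Rightarrow> ('f, 'v) rule list \<Rightarrow> bool" where
  "unifies \<sigma> es \<longleftrightarrow> (\<forall>(s, t) \<in> set es. subst \<sigma> s = subst \<sigma> t)"

definition mgu :: "('v \<Rightarrow> ('f, 'v) term) \<Rightarrow> ('f, 'v) rule list \<Rightarrow> bool" where
  "mgu \<sigma> es \<longleftrightarrow> unifies \<sigma> es \<and> (\<forall>\<tau>. unifies \<tau> es \<longrightarrow> (\<exists>\<delta>. \<tau> = subst_comp \<sigma> \<delta>))"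

definition subst_rule :: "('v \<Rightarrow> ('f, 'v) term) \<Rightarrow> ('f, 'v) rule \<Rightarrow> ('f, 'v) rule" where
  "subst_rule \<sigma> = map_prod (subst \<sigma>) (subst \<sigma>)"

lemma unifies_Nil [simp]: "unifies \<sigma> []"
  by (simp add: unifies_def)

lemma unifies_Cons [simp]: "unifies \<sigma> ((s, t) # es) \<longleftrightarrow> subst \<sigma> s = subst \<sigma> t \<and> unifies \<sigma> es"
  by (simp add: unifies_def)

lemma unifies_append [simp]: "unifies \<sigma> (es @ es') \<longleftrightarrow> unifies \<sigma> es \<and> unifies \<sigma> es'"
  by (auto simp: unifies_def)

lemma unifies_map_subst_rule: "unifies \<tau> (map (subst_rule \<sigma>) es) \<longleftrightarrow> unifies (subst_comp \<sigma> \<tau>) es"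
  by (simp add: unifies_def subst_rule_def subst_subst split_beta)

lemma unifies_zip:
  assumes "length ss = length ts"
  shows "unifies \<sigma> (zip ss ts) \<longleftrightarrow> map (subst \<sigma>) ss = map (subst \<sigma>) ts"
  using assms by (induction rule: list_induct2) auto

lemma unifies_Cons_Fun:
  assumes "length ss = length ts"
  shows "unifies \<sigma> ((Fun f ss, Fun f ts) # es) \<longleftrightarrow> unifies \<sigma> (zip ss ts @ es)"
  using assms by (simp add: unifies_zip)

lemma is_mgu_iff_mgu: "is_mgu \<sigma> s t \<longleftrightarrow> mgu \<sigma> [(s, t)]"
  by (simp add: is_mgu_def mgu_def)

lemma mgu_cong: "(\<And>\<sigma>. unifies \<sigma> es \<longleftrightarrow> unifies \<sigma> es') \<Longrightarrow> mgu \<sigma> es \<longleftrightarrow> mgu \<sigma> es'"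
  by (simp add: mgu_def)

lemma mgu_Cons_swap: "mgu \<sigma> ((s, t) # es) \<longleftrightarrow> mgu \<sigma> ((t, s) # es)"
  by (rule mgu_cong) auto

lemma mgu_Cons_Fun:
  "length ss = length ts \<Longrightarrow> mgu \<sigma> ((Fun f ss, Fun f ts) # es) \<longleftrightarrow> mgu \<sigma> (zip ss ts @ es)"
  by (rule mgu_cong) (rule unifies_Cons_Fun)

lemma unifier_absorbs_elimination:
  "\<tau> x = subst \<tau> t \<Longrightarrow> subst_comp (Var(x := t)) \<tau> = \<tau>"
  by (auto simp: subst_comp_def)

lemma subst_comp_fresh: "x \<notin> vars t \<Longrightarrow> subst (subst_comp (Var(x := s)) \<sigma>) t = subst \<sigma> t"
  by (simp add: subst_fun_upd_fresh flip: subst_subst)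

lemma mgu_eliminate:
  assumes "x \<notin> vars t" "mgu \<sigma> (map (subst_rule (Var(x := t))) es)"
  shows "mgu (subst_comp (Var(x := t)) \<sigma>) ((Var x, t) # es)"
  unfolding mgu_def
proof (intro conjI allI impI)
  let ?\<delta> = "Var(x := t)"
  show "unifies (subst_comp ?\<delta> \<sigma>) ((Var x, t) # es)"
    using assms by (simp add: mgu_def unifies_map_subst_rule subst_comp_fresh)
       (simp add: subst_comp_def)
  fix \<tau> assume "unifies \<tau> ((Var x, t) # es)"
  then have absorbs: "subst_comp ?\<delta> \<tau> = \<tau>" and "unifies \<tau> es"
    by (simp_all add: unifier_absorbs_elimination)
  then have "unifies \<tau> (map (subst_rule ?\<delta>) es)" by (simp add: unifies_map_subst_rule)
  then obtain \<rho> where "\<tau> = subst_comp \<sigma> \<rho>" using assms(2) unfolding mgu_def by blast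
  then show "\<exists>\<rho>. \<tau> = subst_comp (subst_comp ?\<delta> \<sigma>) \<rho>"
    using absorbs by (metis subst_comp_assoc)
qed

lemma unifiable_Var_occurs:
  assumes "\<tau> x = subst \<tau> t" "x \<in> vars t"
  shows "t = Var x"
proof -
  obtain p where occurrence: "p \<in> poss t" "subt_at t p = Var x"
    using assms(2) in_vars_iff_subt_at by metis
  have "p = []"
  proof (rule ccontr)
    assume "p \<noteq> []"
    then have "size (subt_at (subst \<tau> t) p) < size (subst \<tau> t)"
      using occurrence(1) by (intro size_subt_at) auto
    then show False using occurrence assms(1) by simp
  qed
  then show ?thesis using occurrence by simp
qed

definition eqs_vars :: "('f, 'v) rule list \<Rightarrow> 'v set" where
  "eqs_vars es = \<Union>(rule_vars ` set es)"

definition unification_order :: "('f, 'v) rule list rel" where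
  "unification_order = measures [\<lambda>es. card (eqs_vars es), size_list (\<lambda>e. size (fst e))]"

lemma eqs_vars_Cons [simp]: "eqs_vars ((s, t) # es) = vars s \<union> vars t \<union> eqs_vars es"
  by (simp add: eqs_vars_def rule_vars_def)

lemma eqs_vars_append [simp]: "eqs_vars (es @ es') = eqs_vars es \<union> eqs_vars es'"
  by (simp add: eqs_vars_def)

lemma finite_eqs_vars: "finite (eqs_vars es)"
  by (auto simp: eqs_vars_def rule_vars_def)

lemma eqs_vars_zip: "eqs_vars (zip ss ts) \<subseteq> vars (Fun f ss) \<union> vars (Fun f ts)"
  by (auto simp: eqs_vars_def rule_vars_def dest: set_zip_leftD set_zip_rightD)

lemma eqs_vars_eliminate:
  fixes t :: "('f, 'v) term"
  assumes "x \<notin> vars t"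
  shows "eqs_vars (map (subst_rule (Var(x := t))) es) \<subset> insert x (vars t \<union> eqs_vars es)"
proof -
  have "vars (subst (Var(x := t)) s) \<subseteq> vars t \<union> (vars s - {x})" for s :: "('f, 'v) term"
    by (auto simp: vars_subst split: if_splits)
  then have "eqs_vars (map (subst_rule (Var(x := t))) es) \<subseteq> vars t \<union> (eqs_vars es - {x})"
    unfolding eqs_vars_def rule_vars_def subst_rule_def by fastforce
  then show ?thesis using assms by blast
qed

lemma wf_unification_order: "wf unification_order"
  by (simp add: unification_order_def)

lemma unification_order_vars:
  "eqs_vars es \<subset> eqs_vars es' \<Longrightarrow> (es, es') \<in> unification_order"
  by (simp add: unification_order_def psubset_card_mono finite_eqs_vars)

lemma unification_order_size:
  assumes "eqs_vars es \<subseteq> eqs_vars es'"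
    and "size_list (\<lambda>e. size (fst e)) es < size_list (\<lambda>e. size (fst e)) es'"
  shows "(es, es') \<in> unification_order"
  using assms card_mono[OF finite_eqs_vars assms(1)]
  by (auto simp: unification_order_def le_less)

lemma size_list_fst_zip:
  "length ss = length ts \<Longrightarrow> size_list (\<lambda>e. size (fst e)) (zip ss ts) = size_list size ss"
  by (induction rule: list_induct2) auto

lemma unification_order_decompose:
  assumes "length ss = length ts"
  shows "(zip ss ts @ es, (Fun f ss, Fun g ts) # es) \<in> unification_order"
  using eqs_vars_zip[of ss ts]
  by (intro unification_order_size) (auto simp: size_list_fst_zip[OF assms])

lemma mgu_exists_eliminate:
  assumes "\<And>es'. (es', es) \<in> unification_order \<Longrightarrow> unifies \<tau> es' \<Longrightarrow> \<exists>\<sigma>. mgu \<sigma> es'"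
    and "unifies \<tau> ((Var x, t) # es')" "x \<notin> vars t"
    and "eqs_vars es = insert x (vars t \<union> eqs_vars es')"
  shows "\<exists>\<sigma>. mgu \<sigma> ((Var x, t) # es')"
proof -
  let ?es = "map (subst_rule (Var(x := t))) es'"
  have "(?es, es) \<in> unification_order"
    using eqs_vars_eliminate[OF assms(3), of es'] assms(4) by (intro unification_order_vars) simp
  moreover have "unifies \<tau> ?es"
    using assms(2) by (simp add: unifies_map_subst_rule unifier_absorbs_elimination)
  ultimately show ?thesis using assms(1) mgu_eliminate[OF assms(3)] by blast
qed

lemma mgu_exists: "unifies \<tau> es \<Longrightarrow> \<exists>\<sigma>. mgu \<sigma> es"
  using wf_unification_order
proof (induction es rule: wf_induct_rule)
  case (less es)
  note eliminate = mgu_exists_eliminate[OF less.IH]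
  show ?case
  proof (cases es)
    case Nil
    have "mgu Var []" by (simp add: mgu_def subst_comp_def)
    then show ?thesis using Nil by blast
  next
    case (Cons e es')
    then obtain s t where equations: "es = (s, t) # es'" by (cases e) auto
    consider (trivial) x where "s = Var x" "t = Var x"
      | (left) x where "s = Var x" "t \<noteq> Var x"
      | (right) x where "is_Fun s" "t = Var x"
      | (decompose) f g ss ts where "s = Fun f ss" "t = Fun g ts"
      by (cases s; cases t) auto
    then show ?thesis
    proof cases
      case trivial
      have "(es', es) \<in> unification_order"
        unfolding equations by (intro unification_order_size) auto
      then show ?thesis using less equations trivial by (auto simp: mgu_def)
    next
      case left
      then have "x \<notin> vars t" using less.prems equations unifiable_Var_occurs[of \<tau> x t] by auto
      then show ?thesis
        using eliminate[where x = x and t = t and es' = es'] less.prems equations left by simp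
    next
      case right
      then have "x \<notin> vars s" using less.prems equations unifiable_Var_occurs[of \<tau> x s] by auto
      then have "\<exists>\<sigma>. mgu \<sigma> ((t, s) # es')"
        using eliminate[where x = x and t = s and es' = es'] less.prems equations right by auto
      then show ?thesis unfolding equations by (simp add: mgu_Cons_swap)
    next
      case decompose
      then have "f = g" and same_length: "length ss = length ts"
        using less.prems equations map_eq_imp_length_eq by auto
      have "(zip ss ts @ es', es) \<in> unification_order"
        unfolding equations decompose by (rule unification_order_decompose[OF same_length])
      moreover have "unifies \<tau> (zip ss ts @ es')"
        using less.prems unifies_Cons_Fun[OF same_length] \<open>f = g\<close>
        unfolding equations decompose by blast
      ultimately show ?thesis
        using less.IH mgu_Cons_Fun[OF same_length] \<open>f = g\<close>
        unfolding equations decompose by blast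
    qed
  qed
qed

lemma is_mgu_exists: "subst \<tau> s = subst \<tau> t \<Longrightarrow> \<exists>\<sigma>. is_mgu \<sigma> s t"
  using mgu_exists[of \<tau> "[(s, t)]"] by (simp add: is_mgu_iff_mgu)

section \<open>Rewriting\<close>

definition closure_maps :: "(('f, 'v) term \<Rightarrow> ('f, 'v) term) set" where
  "closure_maps = {replace_at u p | u p. p \<in> poss u} \<union> range subst"

definition stable :: "('f, 'v) term rel \<Rightarrow> bool" where
  "stable r \<longleftrightarrow> (\<forall>f \<in> closure_maps. \<forall>(s, t) \<in> r. (f s, f t) \<in> r)"

lemma stableI: "(\<And>f s t. f \<in> closure_maps \<Longrightarrow> (s, t) \<in> r \<Longrightarrow> (f s, f t) \<in> r) \<Longrightarrow> stable r"
  by (auto simp: stable_def)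

lemma stableD: "stable r \<Longrightarrow> f \<in> closure_maps \<Longrightarrow> (s, t) \<in> r \<Longrightarrow> (f s, f t) \<in> r"
  by (auto simp: stable_def)

lemma stable_ctxt:
  "stable r \<Longrightarrow> (s, t) \<in> r \<Longrightarrow> p \<in> poss u \<Longrightarrow> (replace_at u p s, replace_at u p t) \<in> r"
  by (rule stableD) (auto simp: closure_maps_def)

lemma stable_subst: "stable r \<Longrightarrow> (s, t) \<in> r \<Longrightarrow> (subst \<sigma> s, subst \<sigma> t) \<in> r"
  by (rule stableD) (auto simp: closure_maps_def)

lemma stable_relcomp: "stable r \<Longrightarrow> stable r' \<Longrightarrow> stable (r O r')"
  by (rule stableI) (blast dest: stableD)

lemma stable_Un: "stable r \<Longrightarrow> stable r' \<Longrightarrow> stable (r \<union> r')"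
  by (rule stableI) (blast dest: stableD)

lemma stable_converse: "stable r \<Longrightarrow> stable (r\<inverse>)"
  by (rule stableI) (blast dest: stableD)

lemma stable_rtrancl: "stable r \<Longrightarrow> stable (r\<^sup>*)"
  by (rule stableI) (blast intro: rtrancl_map dest: stableD)

lemma stable_args_rtrancl:
  assumes "stable r" "list_all2 (\<lambda>s t. (s, t) \<in> r\<^sup>*) ss ts"
  shows "(Fun f (us @ ss), Fun f (us @ ts)) \<in> r\<^sup>*"
  using assms(2)
proof (induction arbitrary: us rule: list_all2_induct)
  case (Cons s ss t ts)
  have "(replace_at (Fun f (us @ s # ss)) [length us] s,
    replace_at (Fun f (us @ s # ss)) [length us] t) \<in> r\<^sup>*"
    using Cons.hyps(1) by (intro stable_ctxt[OF stable_rtrancl[OF assms(1)]]) auto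
  then show ?case using Cons.IH[of "us @ [t]"] by simp
qed simp

lemma stable_subst_rtrancl:
  assumes "stable r" "\<And>x. (\<sigma> x, \<tau> x) \<in> r\<^sup>*"
  shows "(subst \<sigma> t, subst \<tau> t) \<in> r\<^sup>*"
proof (induction t)
  case (Fun f ts)
  then have "list_all2 (\<lambda>s t. (s, t) \<in> r\<^sup>*) (map (subst \<sigma>) ts) (map (subst \<tau>) ts)"
    by (auto simp: list_all2_conv_all_nth)
  then show ?case using stable_args_rtrancl[OF assms(1), of _ _ f "[]"] by simp
qed (simp add: assms(2))

lemma stable_fun_upd_rtrancl:
  assumes "stable r" "(\<sigma> x, s) \<in> r"
  shows "(subst \<sigma> t, subst (\<sigma>(x := s)) t) \<in> r\<^sup>*"
  using assms by (intro stable_subst_rtrancl) auto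

lemma rstepI:
  "(l, r) \<in> R \<Longrightarrow> p \<in> poss s \<Longrightarrow> subt_at s p = subst \<sigma> l \<Longrightarrow> t = replace_at s p (subst \<sigma> r) \<Longrightarrow>
    (s, t) \<in> rstep R"
  by (auto simp: rstep_def)

lemma rstepE:
  assumes "(s, t) \<in> rstep R"
  obtains l r p \<sigma> where "(l, r) \<in> R" "p \<in> poss s" "subt_at s p = subst \<sigma> l"
    "t = replace_at s p (subst \<sigma> r)"
  using assms by (auto simp: rstep_def)

lemma rstep_rule: "(l, r) \<in> R \<Longrightarrow> (l, r) \<in> rstep R"
  by (rule rstepI[where p = "[]" and \<sigma> = Var]) auto

lemma rstep_mono: "R \<subseteq> R' \<Longrightarrow> rstep R \<subseteq> rstep R'"
  unfolding rstep_def by blast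

lemma rstep_Un: "rstep (R \<union> R') = rstep R \<union> rstep R'"
  unfolding rstep_def by blast

lemma rstep_converse_subset: "rstep (R\<inverse>) \<subseteq> (rstep R)\<inverse>"
proof clarify
  fix s t assume "(s, t) \<in> rstep (R\<inverse>)"
  then obtain l r p \<sigma> where "(r, l) \<in> R" "p \<in> poss s" "subt_at s p = subst \<sigma> l"
    "t = replace_at s p (subst \<sigma> r)" by (auto elim: rstepE)
  then show "(t, s) \<in> rstep R"
    by (intro rstepI[of r l R p t \<sigma>]) (auto, metis replace_at_subt_at)
qed

lemma rstep_converse: "rstep (R\<inverse>) = (rstep R)\<inverse>"
  using rstep_converse_subset[of R] rstep_converse_subset[of "R\<inverse>"] by auto

lemma stable_rstep: "stable (rstep R)"
proof (rule stableI)
  fix f :: "('a, 'b) term \<Rightarrow> ('a, 'b) term" and s t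
  assume closure_map: "f \<in> closure_maps" and "(s, t) \<in> rstep R"
  then obtain l r p \<sigma> where step: "(l, r) \<in> R" "p \<in> poss s" "subt_at s p = subst \<sigma> l"
    "t = replace_at s p (subst \<sigma> r)" by (auto elim: rstepE)
  from closure_map consider (ctxt) u q where "q \<in> poss u" "f = replace_at u q"
    | (subst) \<tau> where "f = subst \<tau>"
    by (auto simp: closure_maps_def)
  then show "(f s, f t) \<in> rstep R"
  proof cases
    case ctxt
    then show ?thesis using step
      by (intro rstepI[of l r R "q @ p" _ \<sigma>])
        (auto simp: poss_append subt_at_append replace_at_append)
  next
    case subst
    then show ?thesis using step
      by (intro rstepI[of l r R p _ "subst_comp \<sigma> \<tau>"]) (auto simp: replace_at_subst subst_subst)
  qed
qed

lemma rstep_least: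
  assumes "stable r" "R \<subseteq> r"
  shows "rstep R \<subseteq> r"
proof clarify
  fix s t assume "(s, t) \<in> rstep R"
  then obtain l r' p \<sigma> where step: "(l, r') \<in> R" "p \<in> poss s" "subt_at s p = subst \<sigma> l"
    "t = replace_at s p (subst \<sigma> r')" by (rule rstepE)
  then have "(replace_at s p (subst \<sigma> l), replace_at s p (subst \<sigma> r')) \<in> r"
    using assms by (intro stable_ctxt stable_subst) auto
  then show "(s, t) \<in> r" using step by (metis replace_at_subt_at)
qed

lemma stable_sstep: "stable (sstep R)"
  unfolding sstep_def by (intro stable_Un stable_converse stable_rstep)

lemma stable_conv: "stable (conv R)"
  unfolding conv_def by (intro stable_rtrancl stable_sstep)

lemma stable_relmod: "stable (relmod R B)"
  unfolding relmod_def by (intro stable_relcomp stable_conv stable_rstep)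

lemma stable_join_mod: "stable (join_mod R B)"
  unfolding join_mod_def
  by (intro stable_relcomp stable_rtrancl stable_converse stable_rstep stable_conv)

lemma sstep_eq_rstep_pm: "sstep B = rstep (pm B)"
  by (simp add: sstep_def pm_def rstep_Un rstep_converse)

lemma sstep_Un: "sstep (R \<union> R') = sstep R \<union> sstep R'"
  by (auto simp: sstep_def rstep_Un)

lemma sym_sstep: "sym (sstep B)"
  by (auto simp: sstep_def intro: symI)

lemma sstep_conv: "(s, t) \<in> sstep B \<Longrightarrow> (s, t) \<in> conv B"
  by (auto simp: conv_def)

lemma rstep_conv: "(s, t) \<in> rstep R \<Longrightarrow> (s, t) \<in> conv R"
  by (auto simp: sstep_def intro: sstep_conv)

lemma pm_conv: "(l, r) \<in> pm B \<Longrightarrow> (l, r) \<in> conv B"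
  by (metis rstep_rule sstep_conv sstep_eq_rstep_pm)

lemma conv_sym: "(s, t) \<in> conv B \<Longrightarrow> (t, s) \<in> conv B"
  unfolding conv_def by (rule symD[OF sym_rtrancl[OF sym_sstep]])

lemma conv_refl [simp]: "(s, s) \<in> conv B"
  by (simp add: conv_def)

lemma conv_trans [trans]: "(s, t) \<in> conv B \<Longrightarrow> (t, u) \<in> conv B \<Longrightarrow> (s, u) \<in> conv B"
  by (auto simp: conv_def)

lemma subset_conv: "R \<subseteq> conv R"
  by (auto intro: rstep_conv rstep_rule)

lemma conv_least:
  assumes "R \<subseteq> conv R'"
  shows "conv R \<subseteq> conv R'"
proof -
  have "rstep R \<subseteq> conv R'" using rstep_least[OF stable_conv assms] .
  then have "sstep R \<subseteq> conv R'" by (auto simp: sstep_def intro: conv_sym)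
  then show ?thesis unfolding conv_def by (rule rtrancl_subset_rtrancl)
qed

lemma relmodI: "(s, s') \<in> conv B \<Longrightarrow> (s', t') \<in> rstep R \<Longrightarrow> (t', t) \<in> conv B \<Longrightarrow> (s, t) \<in> relmod R B"
  unfolding relmod_def by blast

lemma relmodE:
  assumes "(s, t) \<in> relmod R B"
  obtains s' t' where "(s, s') \<in> conv B" "(s', t') \<in> rstep R" "(t', t) \<in> conv B"
  using assms unfolding relmod_def by blast

lemma relmod_mono: "R \<subseteq> R' \<Longrightarrow> relmod R B \<subseteq> relmod R' B"
  unfolding relmod_def by (intro relcomp_mono rstep_mono order_refl)

lemma relmod_conv: "(s, t) \<in> relmod R B \<Longrightarrow> (t, u) \<in> conv B \<Longrightarrow> (s, u) \<in> relmod R B"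
  by (auto elim!: relmodE intro: relmodI conv_trans)

lemma relmod_subset_conv:
  assumes "R \<subseteq> conv T" "B \<subseteq> conv T"
  shows "relmod R B \<subseteq> conv T"
  using rstep_least[OF stable_conv assms(1)] conv_least[OF assms(2)]
  unfolding relmod_def by (blast intro: conv_trans)

lemma join_modI:
  "(s, s') \<in> (rstep R)\<^sup>* \<Longrightarrow> (s', t') \<in> conv B \<Longrightarrow> (t, t') \<in> (rstep R)\<^sup>* \<Longrightarrow> (s, t) \<in> join_mod R B"
  unfolding join_mod_def rtrancl_converse by blast

lemma join_modE:
  assumes "(s, t) \<in> join_mod R B"
  obtains s' t' where "(s, s') \<in> (rstep R)\<^sup>*" "(s', t') \<in> conv B" "(t, t') \<in> (rstep R)\<^sup>*"
  using assms unfolding join_mod_def rtrancl_converse by blast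

lemma join_mod_sym: "(s, t) \<in> join_mod R B \<Longrightarrow> (t, s) \<in> join_mod R B"
  by (elim join_modE) (rule join_modI, auto intro: conv_sym)

definition rstep_at :: "('f, 'v) trs \<Rightarrow> pos \<Rightarrow> ('f, 'v) term rel" where
  "rstep_at R p = {(s, t). \<exists>l r \<sigma>. (l, r) \<in> R \<and> p \<in> poss s \<and>
      subt_at s p = subst \<sigma> l \<and> t = replace_at s p (subst \<sigma> r)}"

lemma rstep_atE:
  assumes "(s, t) \<in> rstep_at R p"
  obtains l r \<sigma> where "(l, r) \<in> R" "p \<in> poss s" "subt_at s p = subst \<sigma> l"
    "t = replace_at s p (subst \<sigma> r)"
  using assms by (auto simp: rstep_at_def)

lemma rstep_at_poss: "(s, t) \<in> rstep_at R p \<Longrightarrow> p \<in> poss s"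
  by (auto simp: rstep_at_def)

lemma rstep_at_rstep: "(s, t) \<in> rstep_at R p \<Longrightarrow> (s, t) \<in> rstep R"
  by (auto simp: rstep_at_def rstep_def)

lemma rstep_rstep_atE:
  assumes "(s, t) \<in> rstep R"
  obtains p where "(s, t) \<in> rstep_at R p"
  using assms by (auto simp: rstep_at_def rstep_def)

lemma rstep_at_appendE:
  assumes "(s, t) \<in> rstep_at R (p @ q)"
  obtains t' where "p \<in> poss s" "(subt_at s p, t') \<in> rstep_at R q" "t = replace_at s p t'"
proof -
  from assms obtain l r \<sigma> where "(l, r) \<in> R" "p \<in> poss s" "q \<in> poss (subt_at s p)"
    "subt_at (subt_at s p) q = subst \<sigma> l"
    "t = replace_at s p (replace_at (subt_at s p) q (subst \<sigma> r))"
    by (auto simp: rstep_at_def poss_append subt_at_append replace_at_append)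
  then show thesis by (intro that) (auto simp: rstep_at_def)
qed

lemma rstep_at_appendI:
  assumes "(subt_at s p, t) \<in> rstep_at R q" "p \<in> poss s"
  shows "(s, replace_at s p t) \<in> rstep_at R (p @ q)"
  using assms unfolding rstep_at_def
  by (clarsimp simp: poss_append subt_at_append replace_at_append) metis

lemma parallel_rsteps_commute:
  assumes "(u, s) \<in> rstep_at R p" "(u, t) \<in> rstep_at S q" "p \<parallel> q"
  obtains v where "(s, v) \<in> rstep S" "(t, v) \<in> rstep R"
proof -
  obtain l r \<sigma> where step_p: "(l, r) \<in> R" "p \<in> poss u" "subt_at u p = subst \<sigma> l"
    "s = replace_at u p (subst \<sigma> r)" using assms(1) by (rule rstep_atE)
  obtain l' r' \<tau> where step_q: "(l', r') \<in> S" "q \<in> poss u" "subt_at u q = subst \<tau> l'"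
    "t = replace_at u q (subst \<tau> r')" using assms(2) by (rule rstep_atE)
  have "q \<parallel> p" using assms(3) parallel_commute by blast
  then show thesis
    using assms(3) step_p step_q
      rstepI[of l' r' S q s \<tau> "replace_at s q (subst \<tau> r')"]
      rstepI[of l r R p t \<sigma> "replace_at s q (subst \<tau> r')"]
    by (intro that) (simp_all add: parallel_poss_replace_at parallel_subt_at_replace_at
      parallel_replace_at_commute)
qed

lemma rstep_at_variable_position:
  assumes "(subst \<sigma> l, s) \<in> rstep_at R p" "linear_term l" "p \<notin> fun_poss l"
  obtains x t where "s = subst (\<sigma>(x := t)) l" "(\<sigma> x, t) \<in> rstep R"
  using rstep_at_poss[OF assms(1)]
proof (cases rule: poss_substE)
  case (variable q q' x)
  obtain l' r \<rho> where step: "(l', r) \<in> R" "subt_at (subst \<sigma> l) p = subst \<rho> l'"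
    "s = replace_at (subst \<sigma> l) p (subst \<rho> r)" using assms(1) by (rule rstep_atE)
  let ?t = "replace_at (\<sigma> x) q' (subst \<rho> r)"
  have "s = subst (\<sigma>(x := ?t)) l"
    using replace_at_linear_subst[OF assms(2) variable(2,3)] step variable by simp
  moreover have "(\<sigma> x, ?t) \<in> rstep R"
    using step variable by (intro rstepI[of l' r R q' _ \<rho>]) (auto simp: subt_at_append)
  ultimately show thesis by (rule that)
qed (use assms in simp)

lemma NF_subt_at:
  assumes "NF R t" "p \<in> poss t"
  shows "NF R (subt_at t p)"
  unfolding NF_def
proof
  assume "\<exists>u. (subt_at t p, u) \<in> rstep R"
  then obtain u where "(replace_at t p (subt_at t p), replace_at t p u) \<in> rstep R"
    using stable_ctxt[OF stable_rstep _ assms(2)] by blast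
  then show False using assms by (auto simp: NF_def)
qed

lemma NF_subst: "NF R (subst \<sigma> t) \<Longrightarrow> NF R t"
  using stable_subst[OF stable_rstep] unfolding NF_def by blast

definition proper_subterms_NF :: "('f, 'v) trs \<Rightarrow> ('f, 'v) term \<Rightarrow> bool" where
  "proper_subterms_NF R t \<longleftrightarrow> (\<forall>p \<in> poss t. p \<noteq> [] \<longrightarrow> NF R (subt_at t p))"

lemma proper_subterms_NF_subst:
  "proper_subterms_NF R (subst \<sigma> t) \<Longrightarrow> proper_subterms_NF R t"
  unfolding proper_subterms_NF_def by (metis NF_subst poss_subst subt_at_subst)

lemma NF_imp_proper_subterms_NF: "NF R t \<Longrightarrow> proper_subterms_NF R t"
  by (simp add: proper_subterms_NF_def NF_subt_at)

lemma innermost_redex: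
  "\<not> NF R t \<Longrightarrow> \<exists>p u. (t, u) \<in> rstep_at R p \<and> proper_subterms_NF R (subt_at t p)"
proof (induction t rule: measure_induct_rule[where f = size])
  case (less t)
  show ?case
  proof (cases "proper_subterms_NF R t")
    case True
    obtain p u where step: "(t, u) \<in> rstep_at R p"
      using less.prems by (auto simp: NF_def elim: rstep_rstep_atE)
    have "proper_subterms_NF R (subt_at t p)"
    proof (cases "p = []")
      case False
      then have "NF R (subt_at t p)"
        using True rstep_at_poss[OF step] by (simp add: proper_subterms_NF_def)
      then show ?thesis by (rule NF_imp_proper_subterms_NF)
    qed (use True in simp)
    then show ?thesis using step by blast
  next
    case False
    then obtain q where reducible_subterm: "q \<in> poss t" "q \<noteq> []" "\<not> NF R (subt_at t q)"
      by (auto simp: proper_subterms_NF_def)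
    from less.IH[OF size_subt_at[OF reducible_subterm(1,2)] reducible_subterm(3)] obtain p u where
      "(subt_at t q, u) \<in> rstep_at R p" "proper_subterms_NF R (subt_at (subt_at t q) p)" by blast
    then show ?thesis
      using reducible_subterm(1) rstep_at_appendI[of t q u R p] by (metis subt_at_append)
  qed
qed

lemma innermost_redex_below:
  assumes "p \<in> poss t" "\<not> proper_subterms_NF R (subt_at t p)"
  obtains q u where "(t, u) \<in> rstep_at R (p @ q)" "proper_subterms_NF R (subt_at t (p @ q))"
proof -
  from assms(2) have "\<not> NF R (subt_at t p)" using NF_imp_proper_subterms_NF by blast
  from innermost_redex[OF this] obtain q u where
    "(subt_at t p, u) \<in> rstep_at R q" "proper_subterms_NF R (subt_at (subt_at t p) q)" by blast
  then show thesis using that rstep_at_appendI assms(1) by (metis subt_at_append)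
qed

section \<open>Prime critical pairs\<close>

abbreviation rename :: "('v \<Rightarrow> 'v) \<Rightarrow> ('f, 'v) term \<Rightarrow> ('f, 'v) term" where
  "rename \<pi> \<equiv> subst (Var \<circ> \<pi>)"

lemma vars_rename: "vars (rename \<pi> t) = \<pi> ` vars t"
  by (auto simp: vars_subst)

lemma subst_rename: "subst \<tau> (rename \<pi> t) = subst (\<tau> \<circ> \<pi>) t"
  by (simp add: subst_subst subst_comp_def comp_def)

lemma variant_iff:
  "variant (l', r') (l, r) \<longleftrightarrow> (\<exists>\<pi>. bij \<pi> \<and> l' = rename \<pi> l \<and> r' = rename \<pi> r)"
  by (simp add: variant_def renaming_def)

lemma variant_refl: "variant e e"
  unfolding variant_def renaming_def by (rule exI[of _ id]) simp

lemma variant_sym: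
  assumes "variant e e'"
  shows "variant e' e"
proof -
  from assms obtain \<pi> where renaming: "bij \<pi>" "fst e = rename \<pi> (fst e')"
    "snd e = rename \<pi> (snd e')"
    by (auto simp: variant_def renaming_def)
  have "rename (inv \<pi>) (rename \<pi> t) = t" for t :: "('a, 'b) term"
    using renaming(1) by (simp add: subst_rename comp_assoc bij_is_inj)
  then show ?thesis
    using renaming unfolding variant_def renaming_def by (metis bij_imp_bij_inv)
qed

lemma variant_trans:
  assumes "variant e1 e2" "variant e2 e3"
  shows "variant e1 e3"
proof -
  from assms obtain \<pi> \<rho> where "bij \<pi>" "bij \<rho>"
    "fst e1 = rename \<pi> (rename \<rho> (fst e3))" "snd e1 = rename \<pi> (rename \<rho> (snd e3))"
    by (auto simp: variant_def renaming_def)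
  then show ?thesis
    unfolding variant_def renaming_def
    by (auto simp: subst_rename comp_assoc intro!: exI[of _ "\<pi> \<circ> \<rho>"] bij_comp)
qed

lemma variant_stable: "variant (l', r') (l, r) \<Longrightarrow> stable Q \<Longrightarrow> (l, r) \<in> Q \<Longrightarrow> (l', r') \<in> Q"
  by (auto simp: variant_iff intro: stable_subst)

lemma variant_same_instance:
  assumes "variant (l', r') (l, r)" "subst \<sigma> l' = subst \<tau> l" "vars r \<subseteq> vars l"
  shows "subst \<sigma> r' = subst \<tau> r"
  using assms by (auto simp: variant_iff subst_rename subst_eq_iff subset_iff)

lemma fresh_renaming:
  assumes "infinite (UNIV :: 'v set)" "finite (A :: 'v set)" "finite (V :: 'v set)"
  obtains \<pi> where "bij \<pi>" "\<pi> ` A \<inter> V = {}"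
proof -
  have "infinite (UNIV - (A \<union> V))" using assms by (simp add: Diff_infinite_finite)
  then obtain C where fresh_set: "C \<subseteq> UNIV - (A \<union> V)" "card C = card A" "finite C"
    using infinite_arbitrarily_large[of "UNIV - (A \<union> V)" "card A"] by metis
  then obtain g where bijection: "bij_betw g A C"
    using assms(2) finite_same_card_bij[of A C] by auto
  define \<pi> where "\<pi> x = (if x \<in> A then g x else if x \<in> C then inv_into A g x else x)" for x
  have "g x \<in> C" if "x \<in> A" for x
    using bijection that by (auto simp: bij_betw_def)
  moreover have "inv_into A g x \<in> A" if "x \<in> C" for x
    using bijection that by (auto simp: bij_betw_def inv_into_into)
  ultimately have "\<pi> (\<pi> x) = x" and "\<pi> ` A \<subseteq> C" for x
    using fresh_set(1) bijection
    by (auto simp: \<pi>_def bij_betw_inv_into_left bij_betw_inv_into_right)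
  then show thesis using that[of \<pi>] fresh_set(1) involuntory_imp_bij by blast
qed

lemma rename_apart:
  fixes l1 r1 :: "('f, 'v) term"
  assumes "infinite (UNIV :: 'v set)"
  obtains l r \<tau> where "variant (l, r) (l1, r1)" "rule_vars (l, r) \<inter> rule_vars (l2, r2) = {}"
    "subst \<tau> l = subst \<sigma>1 l1" "subst \<tau> r = subst \<sigma>1 r1"
    "subst \<tau> l2 = subst \<sigma>2 l2" "subst \<tau> r2 = subst \<sigma>2 r2"
proof -
  obtain \<pi> where apart: "bij \<pi>" "\<pi> ` rule_vars (l1, r1) \<inter> rule_vars (l2, r2) = {}"
    using fresh_renaming[OF assms, of "rule_vars (l1, r1)" "rule_vars (l2, r2)"]
    by (auto simp: rule_vars_def)
  define \<tau> where "\<tau> x = (if x \<in> rule_vars (l2, r2) then \<sigma>2 x else \<sigma>1 (inv \<pi> x))" for x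
  have "\<tau> (\<pi> x) = \<sigma>1 x" if "x \<in> rule_vars (l1, r1)" for x
    using that apart by (auto simp: \<tau>_def bij_is_inj)
  then have "subst \<tau> (rename \<pi> t) = subst \<sigma>1 t" if "vars t \<subseteq> rule_vars (l1, r1)" for t
    using that by (auto simp: subst_rename subst_eq_iff)
  moreover have "subst \<tau> t = subst \<sigma>2 t" if "vars t \<subseteq> rule_vars (l2, r2)" for t
    using that by (auto simp: subst_eq_iff \<tau>_def)
  moreover have "rule_vars (rename \<pi> l1, rename \<pi> r1) = \<pi> ` rule_vars (l1, r1)"
    by (auto simp: rule_vars_def vars_rename)
  moreover have "variant (rename \<pi> l1, rename \<pi> r1) (l1, r1)" using apart(1) variant_iff by blast
  ultimately show thesis
    using apart(2) by (intro that[of "rename \<pi> l1" "rename \<pi> r1" \<tau>]) (auto simp: rule_vars_def)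
qed

lemma PCP2_instance:
  fixes l1 l2 :: "('f, 'v) term"
  assumes "infinite (UNIV :: 'v set)"
    and rules: "(l1, r1) \<in> R1" "(l2, r2) \<in> R2"
    and fun_pos: "p \<in> fun_poss l2"
    and unifiable: "subst \<sigma>1 l1 = subst \<sigma>2 (subt_at l2 p)"
    and prime: "proper_subterms_NF S (subst \<sigma>1 l1)"
    and no_variant: "\<not> (p = [] \<and> variant (l1, r1) (l2, r2))"
  obtains a b \<delta> where "(a, b) \<in> PCP2 S R1 R2"
    "replace_at (subst \<sigma>2 l2) p (subst \<sigma>1 r1) = subst \<delta> a" "subst \<sigma>2 r2 = subst \<delta> b"
proof -
  have pos: "p \<in> poss l2" using fun_pos by (rule fun_poss_imp_poss)
  obtain l r \<tau> where renamed: "variant (l, r) (l1, r1)" "rule_vars (l, r) \<inter> rule_vars (l2, r2) = {}"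
    and combined: "subst \<tau> l = subst \<sigma>1 l1" "subst \<tau> r = subst \<sigma>1 r1"
      "subst \<tau> l2 = subst \<sigma>2 l2" "subst \<tau> r2 = subst \<sigma>2 r2"
    by (rule rename_apart[OF assms(1)])
  have combined_unifies: "subst \<tau> l = subst \<tau> (subt_at l2 p)"
    using combined(1,3) unifiable pos by (metis subt_at_subst)
  then obtain \<sigma> where most_general: "is_mgu \<sigma> l (subt_at l2 p)" using is_mgu_exists by blast
  then obtain \<delta> where "\<tau> = subst_comp \<sigma> \<delta>" using combined_unifies unfolding is_mgu_def by blast
  then have instance_of: "subst \<delta> (subst \<sigma> t) = subst \<tau> t" for t by (simp add: subst_subst)
  have "\<not> (p = [] \<and> variant (l, r) (l2, r2))"
    using no_variant renamed(1) variant_sym variant_trans by blast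
  moreover have "\<exists>e \<in> R1. variant (l, r) e" "\<exists>e \<in> R2. variant (l2, r2) e"
    using rules renamed(1) variant_refl by blast+
  ultimately have "overlap R1 R2 (l, r) p (l2, r2)"
    using renamed(2) fun_pos combined_unifies by (auto simp: overlap_def)
  moreover have "proper_subterms_NF S (subt_at (subst \<sigma> l2) p)"
    using prime combined_unifies combined(1) instance_of subt_at_subst[OF pos]
    by (metis proper_subterms_NF_subst)
  ultimately have "(replace_at (subst \<sigma> l2) p (subst \<sigma> r), subst \<sigma> r2) \<in> PCP2 S R1 R2"
    using most_general unfolding PCP2_def proper_subterms_NF_def by blast
  then show thesis
    by (rule that[of _ _ \<delta>]) (simp_all add: replace_at_subst pos combined instance_of)
qed

lemma prime_overlap_cases:
  fixes l :: "('f, 'v) term"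
  assumes "infinite (UNIV :: 'v set)"
    and step: "(subst \<sigma> l, s) \<in> rstep_at R1 p"
    and rule: "(l, r) \<in> R2" and linear: "linear_term l"
    and prime: "proper_subterms_NF S (subt_at (subst \<sigma> l) p)"
  obtains (variable) x t where "s = subst (\<sigma>(x := t)) l" "(\<sigma> x, t) \<in> rstep R1"
  | (critical) a b \<delta> where "(a, b) \<in> PCP2 S R1 R2" "s = subst \<delta> a" "subst \<sigma> r = subst \<delta> b"
  | (variant) l' r' \<rho> where "(l', r') \<in> R1" "variant (l', r') (l, r)"
      "subst \<rho> l' = subst \<sigma> l" "s = subst \<rho> r'"
proof (cases "p \<in> fun_poss l")
  case False
  from step linear this show thesis by (rule rstep_at_variable_position) (rule variable)
next
  case fun_pos: True
  then have pos: "p \<in> poss l" by (rule fun_poss_imp_poss)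
  from step obtain l' r' \<rho> where inner_rule: "(l', r') \<in> R1" "subt_at (subst \<sigma> l) p = subst \<rho> l'"
    "s = replace_at (subst \<sigma> l) p (subst \<rho> r')" by (rule rstep_atE)
  show thesis
  proof (cases "p = [] \<and> variant (l', r') (l, r)")
    case True
    then show thesis using variant inner_rule by simp
  next
    case False
    have "subst \<rho> l' = subst \<sigma> (subt_at l p)" "proper_subterms_NF S (subst \<rho> l')"
      using inner_rule(2) pos prime by simp_all
    from assms(1) inner_rule(1) rule fun_pos this False obtain a b \<delta> where "(a, b) \<in> PCP2 S R1 R2"
      "replace_at (subst \<sigma> l) p (subst \<rho> r') = subst \<delta> a" "subst \<sigma> r = subst \<delta> b"
      by (rule PCP2_instance)
    then show thesis using inner_rule(3) by (intro critical) simp_all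
  qed
qed

lemma prime_nested_steps:
  fixes u :: "('f, 'v) term"
  assumes "infinite (UNIV :: 'v set)" and linear: "left_linear R2" and "stable Q"
    and inner: "(u, s) \<in> rstep_at R1 (p @ q)" and outer: "(u, t) \<in> rstep_at R2 p"
    and prime: "proper_subterms_NF S (subt_at u (p @ q))"
    and variable_overlap: "\<And>l r \<sigma> x v. (l, r) \<in> R2 \<Longrightarrow> (\<sigma> x, v) \<in> rstep R1 \<Longrightarrow>
      (subst (\<sigma>(x := v)) l, subst \<sigma> r) \<in> Q"
    and critical_pairs: "PCP2 S R1 R2 \<subseteq> Q"
    and variant_overlap: "\<And>l' r' l r \<rho> \<sigma>. (l', r') \<in> R1 \<Longrightarrow> (l, r) \<in> R2 \<Longrightarrow> variant (l', r') (l, r) \<Longrightarrow>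
      subst \<rho> l' = subst \<sigma> l \<Longrightarrow> (subst \<rho> r', subst \<sigma> r) \<in> Q"
  shows "(s, t) \<in> Q"
proof -
  obtain s' where inner_step: "p \<in> poss u" "(subt_at u p, s') \<in> rstep_at R1 q"
    "s = replace_at u p s'"
    using inner by (rule rstep_at_appendE)
  obtain l r \<sigma> where outer_rule: "(l, r) \<in> R2" "subt_at u p = subst \<sigma> l"
    "t = replace_at u p (subst \<sigma> r)"
    using outer by (rule rstep_atE)
  have root_steps: "(subst \<sigma> l, s') \<in> rstep_at R1 q" "proper_subterms_NF S (subt_at (subst \<sigma> l) q)"
    using inner_step outer_rule prime by (simp_all add: subt_at_append)
  have "linear_term l" using linear outer_rule(1) by (auto simp: left_linear_def)
  from assms(1) root_steps(1) outer_rule(1) this root_steps(2) have root_Q: "(s', subst \<sigma> r) \<in> Q"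
  proof (cases rule: prime_overlap_cases)
    case (variable x v)
    then show ?thesis using variable_overlap[OF outer_rule(1)] by simp
  next
    case (critical a b \<delta>)
    then have "(a, b) \<in> Q" using critical_pairs by blast
    then show ?thesis unfolding critical(2,3) by (rule stable_subst[OF \<open>stable Q\<close>])
  next
    case (variant l' r' \<rho>)
    then show ?thesis using variant_overlap[OF variant(1) outer_rule(1)] by simp
  qed
  show ?thesis
    unfolding inner_step(3) outer_rule(3)
    using stable_ctxt[OF \<open>stable Q\<close> root_Q inner_step(1)] .
qed

lemma variable_peak_join_mod:
  assumes "(l, r) \<in> R" "(\<sigma> x, v) \<in> rstep R"
  shows "(subst (\<sigma>(x := v)) l, subst \<sigma> r) \<in> join_mod R B"
proof (rule join_modI)
  show "(subst (\<sigma>(x := v)) l, subst (\<sigma>(x := v)) r) \<in> (rstep R)\<^sup>*"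
    using stable_subst[OF stable_rstep rstep_rule[OF assms(1)]] by blast
  show "(subst \<sigma> r, subst (\<sigma>(x := v)) r) \<in> (rstep R)\<^sup>*"
    using stable_rstep assms(2) by (rule stable_fun_upd_rtrancl)
qed simp

lemma variable_cliff_inner_rule_join_mod:
  assumes "(l, r) \<in> conv B" "(\<sigma> x, v) \<in> rstep R"
  shows "(subst (\<sigma>(x := v)) l, subst \<sigma> r) \<in> join_mod R B"
proof (rule join_modI)
  show "(subst (\<sigma>(x := v)) l, subst (\<sigma>(x := v)) r) \<in> conv B"
    using stable_conv assms(1) by (rule stable_subst)
  show "(subst \<sigma> r, subst (\<sigma>(x := v)) r) \<in> (rstep R)\<^sup>*"
    using stable_rstep assms(2) by (rule stable_fun_upd_rtrancl)
qed simp

lemma variable_cliff_inner_equation_join_mod: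
  assumes "(l, r) \<in> R" "(\<sigma> x, v) \<in> sstep B"
  shows "(subst (\<sigma>(x := v)) l, subst \<sigma> r) \<in> join_mod R B"
proof (rule join_modI)
  show "(subst (\<sigma>(x := v)) l, subst (\<sigma>(x := v)) r) \<in> (rstep R)\<^sup>*"
    using stable_subst[OF stable_rstep rstep_rule[OF assms(1)]] by blast
  have "(subst \<sigma> r, subst (\<sigma>(x := v)) r) \<in> conv B"
    unfolding conv_def using stable_sstep assms(2) by (rule stable_fun_upd_rtrancl)
  then show "(subst (\<sigma>(x := v)) r, subst \<sigma> r) \<in> conv B" by (rule conv_sym)
qed simp

section \<open>Bounded conversions\<close>

locale reduction_order_modulo =
  fixes B :: "('f, 'v) trs" and gt :: "('f, 'v) term rel"
  assumes reduction_order: "reduction_order_mod B gt"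
begin

lemma gt_irrefl: "(s, s) \<notin> gt"
  using reduction_order by (auto simp: reduction_order_mod_def irrefl_def)

lemma gt_trans: "(s, t) \<in> gt \<Longrightarrow> (t, u) \<in> gt \<Longrightarrow> (s, u) \<in> gt"
  using reduction_order by (auto simp: reduction_order_mod_def dest: transD)

lemma wf_gt: "wf (gt\<inverse>)"
  using reduction_order by (auto simp: reduction_order_mod_def)

lemma stable_gt: "stable gt"
  using reduction_order by (auto simp: reduction_order_mod_def stable_def closure_maps_def)

lemma gt_compatible: "conv B O gt O conv B \<subseteq> gt"
  using reduction_order by (auto simp: reduction_order_mod_def)

lemma conv_gt: "(s, t) \<in> conv B \<Longrightarrow> (t, u) \<in> gt \<Longrightarrow> (s, u) \<in> gt"
  using conv_refl[of u B] by (intro subsetD[OF gt_compatible]) blast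

lemma gt_conv: "(s, t) \<in> gt \<Longrightarrow> (t, u) \<in> conv B \<Longrightarrow> (s, u) \<in> gt"
  using conv_refl[of s B] by (intro subsetD[OF gt_compatible]) blast

lemma gt_not_conv: "(s, t) \<in> gt \<Longrightarrow> (s, t) \<notin> conv B"
  using gt_conv[OF _ conv_sym] gt_irrefl by blast

lemma rstep_gt: "R \<subseteq> gt \<Longrightarrow> rstep R \<subseteq> gt"
  by (rule rstep_least[OF stable_gt])

lemma relmod_gt: "R \<subseteq> gt \<Longrightarrow> relmod R B \<subseteq> gt"
  using rstep_gt[of R] gt_compatible unfolding relmod_def by blast

lemma SN_relmod: "R \<subseteq> gt \<Longrightarrow> SN_rel (relmod R B)"
  using relmod_gt[of R] wf_gt unfolding SN_rel_def wf_iff_no_infinite_down_chain by blast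

text \<open>A variable of \<open>r\<close> missing in \<open>l\<close> could be instantiated by \<open>l\<close> itself, so that \<open>l\<close> would
  exceed a term containing it and start an infinite descent.\<close>

lemma gt_vars:
  assumes "(l, r) \<in> gt"
  shows "vars r \<subseteq> vars l"
proof
  fix x assume "x \<in> vars r"
  then obtain p where occurrence: "p \<in> poss r" "subt_at r p = Var x"
    using in_vars_iff_subt_at by metis
  show "x \<in> vars l"
  proof (rule ccontr)
    assume fresh: "x \<notin> vars l"
    define v where "v = subst (Var(x := l)) r"
    have l_in_v: "p \<in> poss v" "subt_at v p = l" using occurrence by (simp_all add: v_def)
    have "(l, v) \<in> gt"
      using stable_subst[OF stable_gt assms, of "Var(x := l)"] fresh
      by (simp add: v_def subst_fun_upd_fresh)
    define descent where "descent k = (replace_at v p ^^ k) l" for k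
    have "(descent k, descent (Suc k)) \<in> gt" for k
    proof (induction k)
      case 0
      show ?case
        using \<open>(l, v) \<in> gt\<close> replace_at_subt_at[OF l_in_v(1)] l_in_v(2) by (simp add: descent_def)
    next
      case (Suc k)
      show ?case using stable_ctxt[OF stable_gt Suc l_in_v(1)] by (simp add: descent_def)
    qed
    then show False
      using wf_gt unfolding wf_iff_no_infinite_down_chain by blast
  qed
qed

definition down_closed :: "('f, 'v) term set \<Rightarrow> bool" where
  "down_closed W \<longleftrightarrow> (\<forall>x \<in> W. \<forall>y. (x, y) \<in> gt \<union> conv B \<longrightarrow> y \<in> W)"

abbreviation below :: "('f, 'v) term \<Rightarrow> ('f, 'v) term set" where
  "below u \<equiv> {x. (u, x) \<in> gt}"

lemma down_closed_below: "down_closed (below u)"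
  unfolding down_closed_def by (auto intro: gt_trans gt_conv)

lemma down_closed_UNIV: "down_closed UNIV"
  by (simp add: down_closed_def)

lemma below_conv: "(u, v) \<in> conv B \<Longrightarrow> below u = below v"
  using conv_gt conv_sym[of u v] by blast

lemma below_subset: "down_closed W \<Longrightarrow> u \<in> W \<Longrightarrow> below u \<subseteq> W"
  unfolding down_closed_def by blast

lemma down_closed_vimage:
  assumes "f \<in> closure_maps" "down_closed W"
  shows "down_closed {x. f x \<in> W}"
proof -
  have "(f x, f y) \<in> gt \<union> conv B" if "(x, y) \<in> gt \<union> conv B" for x y
    using stableD[OF stable_Un[OF stable_gt stable_conv] assms(1) that] .
  then show ?thesis using assms(2) unfolding down_closed_def by blast
qed

end

locale oriented_trs = reduction_order_modulo B gt
  for B :: "('f, 'v) trs" and gt :: "('f, 'v) term rel" +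
  fixes R :: "('f, 'v) trs"
  assumes R_gt: "R \<subseteq> gt"
begin

abbreviation conv_in :: "('f, 'v) term set \<Rightarrow> ('f, 'v) term rel" where
  "conv_in \<equiv> conv_within (sstep (R \<union> B))"

text \<open>Quantifying over \<^emph>\<open>all\<close> down-closed sets makes this notion stable: the preimage of a
  down-closed set under a context or a substitution is again down-closed.\<close>

definition bounded_conv :: "('f, 'v) term rel" where
  "bounded_conv = {(s, t). \<forall>W. down_closed W \<longrightarrow> s \<in> W \<longrightarrow> t \<in> W \<longrightarrow> (s, t) \<in> conv_in W}"

definition descending_conv :: "('f, 'v) term rel" where
  "descending_conv = {(s, t). \<exists>u. (s, u) \<in> rstep R \<and> (u, t) \<in> conv_in (below s)}"

lemma rstep_below: "(s, t) \<in> rstep R \<Longrightarrow> t \<in> below s"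
  using rstep_gt[OF R_gt] by blast

lemma conv_in_sym: "(s, t) \<in> conv_in W \<Longrightarrow> (t, s) \<in> conv_in W"
  by (rule conv_within_sym[OF sym_sstep])

lemma conv_in_steps:
  assumes "(s, t) \<in> (rstep R \<union> sstep B)\<^sup>*" "down_closed W" "s \<in> W"
  shows "(s, t) \<in> conv_in W"
  using assms(1)
proof (induction rule: rtrancl_induct)
  case (step t u)
  have "t \<in> W" using conv_within_closed[OF step.IH assms(3)] .
  moreover have "u \<in> W"
    using \<open>t \<in> W\<close> step.hyps(2) assms(2) rstep_gt[OF R_gt] sstep_conv unfolding down_closed_def
    by blast
  moreover have "(t, u) \<in> sstep (R \<union> B)" using step.hyps(2) by (auto simp: sstep_def rstep_Un)
  ultimately show ?case using step.IH by (blast intro: conv_within_trans conv_within_step)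
qed simp

lemma conv_in_rsteps:
  assumes "(s, t) \<in> (rstep R)\<^sup>*" "down_closed W" "s \<in> W"
  shows "(s, t) \<in> conv_in W"
  using conv_in_steps[OF subsetD[OF rtrancl_mono assms(1)] assms(2,3)] by blast

lemma conv_in_conv:
  assumes "(s, t) \<in> conv B" "down_closed W" "s \<in> W"
  shows "(s, t) \<in> conv_in W"
  using conv_in_steps[OF subsetD[OF rtrancl_mono assms(1)[unfolded conv_def]] assms(2,3)] by blast

lemma conv_in_map:
  assumes "f \<in> closure_maps" "(s, t) \<in> conv_in V" "V \<subseteq> {x. f x \<in> W}"
  shows "(f s, f t) \<in> conv_in W"
  using conv_within_mono[OF assms(3,2)] stableD[OF stable_sstep assms(1)] by (rule conv_within_map)

lemma bounded_convI:
  "(\<And>W. down_closed W \<Longrightarrow> s \<in> W \<Longrightarrow> t \<in> W \<Longrightarrow> (s, t) \<in> conv_in W) \<Longrightarrow> (s, t) \<in> bounded_conv"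
  by (simp add: bounded_conv_def)

lemma bounded_convD:
  "(s, t) \<in> bounded_conv \<Longrightarrow> down_closed W \<Longrightarrow> s \<in> W \<Longrightarrow> t \<in> W \<Longrightarrow> (s, t) \<in> conv_in W"
  by (simp add: bounded_conv_def)

lemma descending_convI:
  "(s, u) \<in> rstep R \<Longrightarrow> (u, t) \<in> conv_in (below s) \<Longrightarrow> (s, t) \<in> descending_conv"
  by (auto simp: descending_conv_def)

lemma descending_convE:
  assumes "(s, t) \<in> descending_conv"
  obtains u where "(s, u) \<in> rstep R" "(u, t) \<in> conv_in (below s)"
  using assms by (auto simp: descending_conv_def)

lemma rstep_descending: "(s, t) \<in> rstep R \<Longrightarrow> (s, t) \<in> descending_conv"
  by (rule descending_convI) auto

lemma descending_conv_trans:
  assumes "(s, t) \<in> descending_conv" "(t, u) \<in> conv_in (below s)"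
  shows "(s, u) \<in> descending_conv"
  using assms(1)
  by (rule descending_convE) (rule descending_convI, auto intro: conv_within_trans assms(2))

lemma descending_conv_gt: "descending_conv \<subseteq> gt"
proof clarify
  fix s t assume "(s, t) \<in> descending_conv"
  then obtain u where "(s, u) \<in> rstep R" "(u, t) \<in> conv_in (below s)" by (rule descending_convE)
  then have "t \<in> below s" using rstep_below by (intro conv_within_closed[of u t])
  then show "(s, t) \<in> gt" by simp
qed

lemma stable_bounded_conv: "stable bounded_conv"
proof (rule stableI, rule bounded_convI)
  fix f :: "('f, 'v) term \<Rightarrow> ('f, 'v) term" and s t W
  assume closure_map: "f \<in> closure_maps" and bounded: "(s, t) \<in> bounded_conv"
    and in_W: "down_closed W" "f s \<in> W" "f t \<in> W"
  have "(s, t) \<in> conv_in {x. f x \<in> W}"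
    using bounded_convD[OF bounded down_closed_vimage[OF closure_map in_W(1)]] in_W(2,3) by simp
  then show "(f s, f t) \<in> conv_in W" by (rule conv_in_map[OF closure_map]) simp
qed

lemma stable_descending_conv: "stable descending_conv"
proof (rule stableI)
  fix f :: "('f, 'v) term \<Rightarrow> ('f, 'v) term" and s t
  assume closure_map: "f \<in> closure_maps" and "(s, t) \<in> descending_conv"
  then obtain u where first_step: "(s, u) \<in> rstep R" "(u, t) \<in> conv_in (below s)"
    by (blast elim: descending_convE)
  have "below s \<subseteq> {x. f x \<in> below (f s)}" using stableD[OF stable_gt closure_map] by blast
  then have "(f u, f t) \<in> conv_in (below (f s))" by (rule conv_in_map[OF closure_map first_step(2)])
  with stableD[OF stable_rstep closure_map first_step(1)] show "(f s, f t) \<in> descending_conv"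
    by (rule descending_convI)
qed

lemma bounded_conv_sym: "(s, t) \<in> bounded_conv \<Longrightarrow> (t, s) \<in> bounded_conv"
  by (rule bounded_convI) (rule conv_in_sym, rule bounded_convD)

lemma bounded_conv_subset_conv: "bounded_conv \<subseteq> conv (R \<union> B)"
  using bounded_convD[OF _ down_closed_UNIV] by (auto simp: conv_within_UNIV conv_def)

lemma conv_bounded: "conv B \<subseteq> bounded_conv"
  by (auto intro: bounded_convI conv_in_conv)

lemma descending_conv_in:
  assumes "(s, t) \<in> descending_conv" "down_closed W" "s \<in> W"
  shows "(s, t) \<in> conv_in W"
proof -
  obtain u where first_step: "(s, u) \<in> rstep R" "(u, t) \<in> conv_in (below s)"
    using assms(1) by (rule descending_convE)
  have "(s, u) \<in> conv_in W" using conv_in_rsteps first_step(1) assms(2,3) by blast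
  also have "(u, t) \<in> conv_in W"
    using conv_within_mono[OF below_subset[OF assms(2,3)] first_step(2)] .
  finally show ?thesis .
qed

lemma descending_bounded: "descending_conv \<subseteq> bounded_conv"
  by (auto intro: bounded_convI descending_conv_in)

lemma relmod_conv_in:
  assumes "(s, t) \<in> relmod T B" "T \<subseteq> descending_conv" "down_closed W" "s \<in> W"
  shows "(s, t) \<in> conv_in W"
proof -
  obtain s' t' where decomposition: "(s, s') \<in> conv B" "(s', t') \<in> rstep T" "(t', t) \<in> conv B"
    using assms(1) by (rule relmodE)
  have before: "(s, s') \<in> conv_in W" using conv_in_conv[OF decomposition(1) assms(3,4)] .
  then have "s' \<in> W" using assms(4) by (rule conv_within_closed)
  have "(s', t') \<in> descending_conv"
    using decomposition(2) rstep_least[OF stable_descending_conv assms(2)] by blast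
  then have rewrite: "(s', t') \<in> conv_in W" using assms(3) \<open>s' \<in> W\<close> by (rule descending_conv_in)
  then have "t' \<in> W" using \<open>s' \<in> W\<close> by (rule conv_within_closed)
  note before
  also note rewrite
  also have "(t', t) \<in> conv_in W" using conv_in_conv[OF decomposition(3) assms(3) \<open>t' \<in> W\<close>] .
  finally show ?thesis .
qed

lemma join_mod_bounded: "join_mod R B \<subseteq> bounded_conv"
proof clarify
  fix s t assume "(s, t) \<in> join_mod R B"
  then obtain s' t' where valley: "(s, s') \<in> (rstep R)\<^sup>*" "(s', t') \<in> conv B"
    "(t, t') \<in> (rstep R)\<^sup>*"
    by (rule join_modE)
  show "(s, t) \<in> bounded_conv"
  proof (rule bounded_convI)
    fix W assume in_W: "down_closed W" "s \<in> W" "t \<in> W"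
    have left: "(s, s') \<in> conv_in W" using conv_in_rsteps[OF valley(1) in_W(1,2)] .
    also have "(s', t') \<in> conv_in W"
      using conv_in_conv[OF valley(2) in_W(1) conv_within_closed[OF left in_W(2)]] .
    also have "(t', t) \<in> conv_in W"
      using conv_in_rsteps[OF valley(3) in_W(1,3)] by (rule conv_in_sym)
    finally show "(s, t) \<in> conv_in W" .
  qed
qed

lemma join_mod_descending:
  assumes "(s, t) \<in> join_mod R B" "(s, t) \<in> gt"
  shows "(s, t) \<in> descending_conv"
proof -
  obtain s' t' where valley: "(s, s') \<in> (rstep R)\<^sup>*" "(s', t') \<in> conv B" "(t, t') \<in> (rstep R)\<^sup>*"
    using assms(1) by (rule join_modE)
  have "(t, t') \<in> conv_in (below s)"
    using conv_in_rsteps[OF valley(3) down_closed_below] assms(2) by simp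
  then have "(s, t') \<in> gt" using conv_within_closed assms(2) by fastforce
  then have "s \<noteq> s'" using gt_not_conv valley(2) by blast
  then obtain u where first_step: "(s, u) \<in> rstep R" "(u, s') \<in> (rstep R)\<^sup>*"
    using valley(1) by (metis converse_rtranclE)
  have "(u, t) \<in> bounded_conv"
    using join_mod_bounded join_modI[OF first_step(2) valley(2,3)] by blast
  then have "(u, t) \<in> conv_in (below s)"
    using bounded_convD[OF _ down_closed_below] rstep_below[OF first_step(1)] assms(2) by simp
  with first_step(1) show ?thesis by (rule descending_convI)
qed

lemma relmod_bounded:
  assumes "(s, u) \<in> relmod T B" "T \<subseteq> descending_conv" "(u, t) \<in> bounded_conv"
  shows "(s, t) \<in> bounded_conv"
proof (rule bounded_convI)
  fix W assume in_W: "down_closed W" "s \<in> W" "t \<in> W"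
  have rewrite: "(s, u) \<in> conv_in W" using relmod_conv_in[OF assms(1,2) in_W(1,2)] .
  also have "(u, t) \<in> conv_in W"
    using bounded_convD[OF assms(3) in_W(1) conv_within_closed[OF rewrite in_W(2)] in_W(3)] .
  finally show "(s, t) \<in> conv_in W" .
qed

lemma descending_conv_bounded:
  assumes "(s, u) \<in> descending_conv" "(s, t) \<in> gt" "(u, t) \<in> bounded_conv"
  shows "(s, t) \<in> descending_conv"
proof -
  have "(s, u) \<in> gt" using assms(1) descending_conv_gt by blast
  then have "(u, t) \<in> conv_in (below s)"
    using bounded_convD[OF assms(3) down_closed_below] assms(2) by simp
  with assms(1) show ?thesis by (rule descending_conv_trans)
qed

abbreviation cliff_conv :: "('f, 'v) term rel" where
  "cliff_conv \<equiv> join_mod R B \<union> descending_conv \<union> descending_conv\<inverse>"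

lemma stable_cliff_conv: "stable cliff_conv"
  by (intro stable_Un stable_converse stable_join_mod stable_descending_conv)

lemma cliff_conv_sym: "(s, t) \<in> cliff_conv \<Longrightarrow> (t, s) \<in> cliff_conv"
  by (auto intro: join_mod_sym)

end

section \<open>Local peaks and cliffs\<close>

locale fair_trs = oriented_trs B gt R
  for B :: "('f, 'v) trs" and gt :: "('f, 'v) term rel" and R :: "('f, 'v) trs" +
  assumes infinite_vars: "infinite (UNIV :: 'v set)"
    and left_linear_R: "left_linear R" and left_linear_B: "left_linear (pm B)"
    and PCP_bounded: "PCP R \<subseteq> bounded_conv"
    and PCPpm_cliff_conv: "PCPpm R (pm B) \<subseteq> cliff_conv"
begin

lemma cliff_gt:
  assumes "(u, s) \<in> rstep R" "(u, t) \<in> sstep B"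
  shows "(t, s) \<in> gt"
  using rstep_below[OF assms(1)] conv_gt[OF conv_sym[OF sstep_conv[OF assms(2)]]] by simp

lemma cliff_conv_descending:
  assumes "(u, s) \<in> rstep R" "(u, t) \<in> sstep B" "(t, s) \<in> cliff_conv"
  shows "(t, s) \<in> descending_conv"
proof -
  have decrease: "(t, s) \<in> gt" using cliff_gt[OF assms(1,2)] .
  have "(s, t) \<notin> descending_conv"
    using descending_conv_gt gt_trans[OF decrease] gt_irrefl by blast
  then show ?thesis using assms(3) join_mod_descending[OF _ decrease] by blast
qed

lemma prime_peak:
  assumes inner: "(u, s) \<in> rstep_at R (p @ q)" and outer: "(u, t) \<in> rstep_at R p"
    and prime: "proper_subterms_NF R (subt_at u (p @ q))"
  shows "(s, t) \<in> conv_in (below u)"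
proof -
  from infinite_vars left_linear_R stable_bounded_conv inner outer prime
  have "(s, t) \<in> bounded_conv"
  proof (rule prime_nested_steps)
    show "(subst (\<sigma>(x := v)) l, subst \<sigma> r) \<in> bounded_conv"
      if "(l, r) \<in> R" "(\<sigma> x, v) \<in> rstep R" for l r \<sigma> x v
      using variable_peak_join_mod[of l r R \<sigma> x v] that join_mod_bounded by blast
    show "PCP2 R R R \<subseteq> bounded_conv" using PCP_bounded by (simp add: PCP_def)
    show "(subst \<rho> r', subst \<sigma> r) \<in> bounded_conv"
      if "(l, r) \<in> R" "variant (l', r') (l, r)" "subst \<rho> l' = subst \<sigma> l" for l' r' l r \<rho> \<sigma>
    proof -
      have "vars r \<subseteq> vars l" using gt_vars that(1) R_gt by blast
      then show ?thesis using variant_same_instance[OF that(2,3)] conv_bounded by auto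
    qed
  qed
  then show ?thesis
    using down_closed_below rstep_below[OF rstep_at_rstep[OF inner]]
      rstep_below[OF rstep_at_rstep[OF outer]] by (rule bounded_convD)
qed

lemma prime_cliff_inner_rule:
  assumes inner: "(u, s) \<in> rstep_at R (p @ q)" and outer: "(u, t) \<in> rstep_at (pm B) p"
    and prime: "proper_subterms_NF R (subt_at u (p @ q))"
  shows "(t, s) \<in> descending_conv"
proof -
  from infinite_vars left_linear_B stable_cliff_conv inner outer prime
  have "(s, t) \<in> cliff_conv"
  proof (rule prime_nested_steps)
    show "(subst (\<sigma>(x := v)) l, subst \<sigma> r) \<in> cliff_conv"
      if "(l, r) \<in> pm B" "(\<sigma> x, v) \<in> rstep R" for l r \<sigma> x v
      using variable_cliff_inner_rule_join_mod[of l r B \<sigma> x v R] pm_conv[OF that(1)] that(2)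
      by simp
    show "PCP2 R R (pm B) \<subseteq> cliff_conv" using PCPpm_cliff_conv by (simp add: PCPpm_def)
    show "(subst \<rho> r', subst \<sigma> r) \<in> cliff_conv"
      if "(l', r') \<in> R" "(l, r) \<in> pm B" "variant (l', r') (l, r)" for l' r' l r \<rho> \<sigma>
      using variant_stable[OF that(3) stable_conv pm_conv[OF that(2)]] gt_not_conv that(1) R_gt
      by blast
  qed
  then have "(t, s) \<in> cliff_conv" by (rule cliff_conv_sym)
  then show ?thesis
    using cliff_conv_descending inner outer rstep_at_rstep sstep_eq_rstep_pm by metis
qed

lemma prime_cliff_inner_equation:
  assumes inner: "(u, t) \<in> rstep_at (pm B) (p @ q)" and outer: "(u, s) \<in> rstep_at R p"
    and prime: "proper_subterms_NF R (subt_at u (p @ q))"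
  shows "(t, s) \<in> descending_conv"
proof -
  from infinite_vars left_linear_R stable_cliff_conv inner outer prime
  have "(t, s) \<in> cliff_conv"
  proof (rule prime_nested_steps)
    show "(subst (\<sigma>(x := v)) l, subst \<sigma> r) \<in> cliff_conv"
      if "(l, r) \<in> R" "(\<sigma> x, v) \<in> rstep (pm B)" for l r \<sigma> x v
      using variable_cliff_inner_equation_join_mod[of l r R \<sigma> x v B] that
      by (simp add: sstep_eq_rstep_pm)
    show "PCP2 R (pm B) R \<subseteq> cliff_conv" using PCPpm_cliff_conv by (simp add: PCPpm_def)
    show "(subst \<rho> r', subst \<sigma> r) \<in> cliff_conv"
      if "(l', r') \<in> pm B" "(l, r) \<in> R" "variant (l', r') (l, r)" for l' r' l r \<rho> \<sigma>
      using variant_stable[OF that(3) stable_gt] that(2) R_gt gt_not_conv pm_conv[OF that(1)]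
      by blast
  qed
  then show ?thesis
    using cliff_conv_descending inner outer rstep_at_rstep sstep_eq_rstep_pm by metis
qed

text \<open>A non-prime overlap has an innermost redex strictly below the inner position;
  contracting it splits the peak into two prime ones.\<close>

lemma nested_peak:
  assumes inner: "(u, s) \<in> rstep_at R (p @ q)" and outer: "(u, t) \<in> rstep_at R p"
  shows "(s, t) \<in> conv_in (below u)"
proof (cases "proper_subterms_NF R (subt_at u (p @ q))")
  case True
  with inner outer show ?thesis by (rule prime_peak)
next
  case False
  obtain q' w where innermost: "(u, w) \<in> rstep_at R ((p @ q) @ q')"
    "proper_subterms_NF R (subt_at u ((p @ q) @ q'))"
    using rstep_at_poss[OF inner] False by (rule innermost_redex_below)
  have "(s, w) \<in> conv_in (below u)"
    using prime_peak[OF innermost(1) inner innermost(2)] by (rule conv_in_sym)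
  also have "(w, t) \<in> conv_in (below u)"
    using prime_peak[of u w p "q @ q'" t] innermost outer by simp
  finally show ?thesis .
qed

lemma local_peak:
  assumes "(u, s) \<in> rstep R" "(u, t) \<in> rstep R"
  shows "(s, t) \<in> conv_in (below u)"
proof -
  obtain p where step_at_p: "(u, s) \<in> rstep_at R p" using assms(1) by (rule rstep_rstep_atE)
  obtain q where step_at_q: "(u, t) \<in> rstep_at R q" using assms(2) by (rule rstep_rstep_atE)
  consider (below) "prefix p q" | (above) "prefix q p" | (parallel) "p \<parallel> q" by blast
  then show ?thesis
  proof cases
    case below
    then have "(t, s) \<in> conv_in (below u)"
      using nested_peak step_at_p step_at_q unfolding prefix_def by blast
    then show ?thesis by (rule conv_in_sym)
  next
    case above
    then show ?thesis using nested_peak step_at_p step_at_q unfolding prefix_def by blast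
  next
    case parallel
    obtain v where joined: "(s, v) \<in> rstep R" "(t, v) \<in> rstep R"
      using step_at_p step_at_q parallel by (rule parallel_rsteps_commute)
    have "(s, v) \<in> conv_in (below u)"
      using conv_in_rsteps[OF _ down_closed_below rstep_below[OF assms(1)]] joined(1) by blast
    also have "(v, t) \<in> conv_in (below u)"
      using conv_in_rsteps[OF _ down_closed_below rstep_below[OF assms(2)]] joined(2)
      by (blast intro: conv_in_sym)
    finally show ?thesis .
  qed
qed

lemma cliff_peak_trans:
  assumes "(t, w) \<in> descending_conv" "(u, t) \<in> sstep B" "(u, w) \<in> rstep R" "(u, s) \<in> rstep R"
  shows "(t, s) \<in> descending_conv"
  using assms(1) local_peak[OF assms(3,4)] below_conv[OF sstep_conv[OF assms(2)]]
  by (simp add: descending_conv_trans)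

lemma nonprime_cliff:
  assumes rule: "(u, s) \<in> rstep R" and equation: "(u, t) \<in> rstep_at (pm B) p"
    and "p @ q \<in> poss u" "\<not> proper_subterms_NF R (subt_at u (p @ q))"
  shows "(t, s) \<in> descending_conv"
proof -
  obtain q' w where innermost: "(u, w) \<in> rstep_at R ((p @ q) @ q')"
    "proper_subterms_NF R (subt_at u ((p @ q) @ q'))"
    using assms(3,4) by (rule innermost_redex_below)
  have "(t, w) \<in> descending_conv"
    using prime_cliff_inner_rule[of u w p "q @ q'" t] innermost equation by simp
  moreover have "(u, t) \<in> sstep B" using equation by (simp add: sstep_eq_rstep_pm rstep_at_rstep)
  ultimately show ?thesis using rstep_at_rstep[OF innermost(1)] rule by (rule cliff_peak_trans)
qed

lemma parallel_cliff:
  assumes "(u, s) \<in> rstep_at R p" "(u, t) \<in> rstep_at (pm B) q" "p \<parallel> q"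
  shows "(t, s) \<in> descending_conv"
proof -
  obtain v where equation_step: "(s, v) \<in> rstep (pm B)" and rule_step: "(t, v) \<in> rstep R"
    using assms by (rule parallel_rsteps_commute)
  have "(v, s) \<in> conv B"
    using equation_step by (auto simp flip: sstep_eq_rstep_pm intro: sstep_conv conv_sym)
  then have "(v, s) \<in> conv_in (below t)"
    using down_closed_below rstep_below[OF rule_step] by (rule conv_in_conv)
  with rule_step show ?thesis by (rule descending_convI)
qed

lemma local_cliff:
  assumes "(u, s) \<in> rstep R" "(u, t) \<in> sstep B"
  shows "(t, s) \<in> descending_conv"
proof -
  obtain p where rule_at_p: "(u, s) \<in> rstep_at R p" using assms(1) by (rule rstep_rstep_atE)
  obtain q where equation_at_q: "(u, t) \<in> rstep_at (pm B) q"
    using assms(2) unfolding sstep_eq_rstep_pm by (rule rstep_rstep_atE)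
  consider (equation_below) q' where "q = p @ q'" | (rule_below) p' where "p = q @ p'"
    | (parallel) "p \<parallel> q" by (metis parallelI prefixE)
  then show ?thesis
  proof cases
    case equation_below
    show ?thesis
    proof (cases "proper_subterms_NF R (subt_at u q)")
      case True
      with equation_at_q rule_at_p show ?thesis
        unfolding equation_below by (rule prime_cliff_inner_equation)
    next
      case False
      with rstep_at_poss[OF equation_at_q] show ?thesis
        using nonprime_cliff[OF assms(1) equation_at_q, of "[]"] by simp
    qed
  next
    case rule_below
    show ?thesis
    proof (cases "proper_subterms_NF R (subt_at u p)")
      case True
      with rule_at_p equation_at_q show ?thesis
        unfolding rule_below by (rule prime_cliff_inner_rule)
    next
      case False
      with rstep_at_poss[OF rule_at_p] show ?thesis
        unfolding rule_below by (rule nonprime_cliff[OF assms(1) equation_at_q])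
    qed
  next
    case parallel
    with rule_at_p equation_at_q show ?thesis by (rule parallel_cliff)
  qed
qed

lemma church_rosser: "conv (R \<union> B) \<subseteq> join_mod R B"
proof -
  have sstep_eq: "sstep (R \<union> B) = rstep R \<union> (rstep R)\<inverse> \<union> sstep B"
    by (simp add: sstep_Un) (simp add: sstep_def)
  interpret abstract: locally_decreasing_modulo "rstep R" "sstep B" gt
  proof
    show "(sstep B)\<^sup>* O gt O (sstep B)\<^sup>* \<subseteq> gt" using gt_compatible unfolding conv_def .
    show "(s, t) \<in> conv_within (rstep R \<union> (rstep R)\<inverse> \<union> sstep B) (below u)"
      if "(u, s) \<in> rstep R" "(u, t) \<in> rstep R" for u s t
      using local_peak[OF that] unfolding sstep_eq .
    show "\<exists>v. (t, v) \<in> rstep R \<and>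
        (v, s) \<in> conv_within (rstep R \<union> (rstep R)\<inverse> \<union> sstep B) (below u)"
      if "(u, s) \<in> rstep R" "(u, t) \<in> sstep B" for u s t
      using local_cliff[OF that] below_conv[OF sstep_conv[OF that(2)]]
      by (auto simp flip: sstep_eq elim: descending_convE)
  qed (use wf_gt rstep_gt[OF R_gt] sym_sstep in auto)
  show ?thesis using abstract.church_rosser unfolding join_mod_def conv_def sstep_eq .
qed

end

section \<open>Fair runs\<close>

lemma runD: "run step E S n \<Longrightarrow> i < n \<Longrightarrow> step (S i) (S (Suc i))"
  by (simp add: run_def)

lemma run_start: "run step E S n \<Longrightarrow> S 0 = (E, {})"
  by (simp add: run_def)

lemma run_iff_rtranclp: "(\<exists>S n. run step E S n \<and> S n = T) \<longleftrightarrow> step\<^sup>*\<^sup>* (E, {}) T"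
  unfolding run_def rtranclp_power relpowp_fun_conv by blast

context reduction_order_modulo
begin

lemma IA_step_gt: "IA_step B gt S S' \<Longrightarrow> snd S \<subseteq> gt \<Longrightarrow> snd S' \<subseteq> gt"
proof (induction rule: IA_step.induct)
  case (deduce_cliff s t R E)
  then obtain u where "(u, s) \<in> rstep R" "(u, t) \<in> sstep B" by blast
  then have "(t, s) \<in> gt"
    using rstep_gt[of R] deduce_cliff.prems conv_gt[OF conv_sym[OF sstep_conv]] by auto
  then show ?case using deduce_cliff.prems by simp
next
  case (compose s t R u E)
  then have "(s, t) \<in> gt" "(t, u) \<in> gt" using relmod_gt[of "R - {(s, t)}"] by auto
  then show ?case using compose.prems gt_trans by auto
qed auto

lemma IA_run_gt:
  assumes "run (IA_step B gt) E S n" "i \<le> n"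
  shows "snd (S i) \<subseteq> gt"
  using assms(2)
proof (induction i)
  case 0
  then show ?case using run_start[OF assms(1)] by simp
next
  case (Suc i)
  then show ?case using IA_step_gt[OF runD[OF assms(1)]] by simp
qed

end

context oriented_trs
begin

lemma IA_step_descending:
  assumes "IA_step B gt S S'" "snd S \<subseteq> gt" "fst S' \<subseteq> bounded_conv" "snd S' \<subseteq> descending_conv"
  shows "snd S \<subseteq> descending_conv"
  using assms
proof (induction rule: IA_step.induct)
  case (collapse s t T u E)
  have "(s, u) \<in> descending_conv"
    using collapse rstep_least[OF stable_descending_conv, of "T - {(s, t)}"] by auto
  then have "(s, t) \<in> descending_conv"
    using collapse bounded_conv_sym by (intro descending_conv_bounded[of s u t]) auto
  then show ?case using collapse by auto
next
  case (compose s t T u E)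
  have "(t, u) \<in> bounded_conv"
    using compose conv_bounded by (intro relmod_bounded[of t u "T - {(s, t)}" u]) auto
  then have "(s, t) \<in> descending_conv"
    using compose bounded_conv_sym by (intro descending_conv_bounded[of s u t]) auto
  then show ?case using compose by auto
qed auto

lemma IA_step_bounded:
  assumes "IA_step B gt S S'" "fst S' \<subseteq> bounded_conv" "snd S' \<subseteq> descending_conv"
  shows "fst S \<subseteq> bounded_conv"
  using assms
proof (induction rule: IA_step.induct)
  case (orient e E s t T)
  then have "(s, t) \<in> bounded_conv" using descending_bounded by auto
  then show ?case using orient bounded_conv_sym by auto
next
  case (delete s t E T)
  then show ?case using conv_bounded by auto
next
  case (simplify e E s t u T)
  then have "(s, t) \<in> bounded_conv" by (intro relmod_bounded[of s u T t]) auto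
  then show ?case using simplify bounded_conv_sym by auto
qed auto

lemma IA_run_bounded:
  assumes "run (IA_step B gt) E S n" "S n = ({}, R)" "i \<le> n"
  shows "fst (S i) \<subseteq> bounded_conv \<and> snd (S i) \<subseteq> descending_conv"
  using assms(3)
proof (induction rule: inc_induct)
  case base
  show ?case using assms(2) by (auto intro: rstep_descending rstep_rule)
next
  case (step i)
  have "snd (S i) \<subseteq> gt" using IA_run_gt[OF assms(1)] step.hyps by simp
  then show ?case
    using IA_step_descending IA_step_bounded runD[OF assms(1)] step by metis
qed

lemma IA_run_sstep_bounded:
  assumes "run (IA_step B gt) E S n" "S n = ({}, R)" "i \<le> n"
  shows "sstep (fst (S i) \<union> snd (S i)) \<subseteq> bounded_conv"
proof -
  have "fst (S i) \<union> snd (S i) \<subseteq> bounded_conv"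
    using IA_run_bounded[OF assms] descending_bounded by blast
  from rstep_least[OF stable_bounded_conv this] show ?thesis
    by (auto simp: sstep_def intro: bounded_conv_sym)
qed

lemma IA_run_sstep_descending:
  assumes "run (IA_step B gt) E S n" "S n = ({}, R)" "i \<le> n"
  shows "sstep (snd (S i)) \<subseteq> descending_conv \<union> descending_conv\<inverse>"
  using rstep_least[OF stable_descending_conv conjunct2[OF IA_run_bounded[OF assms]]]
  by (auto simp: sstep_def)

lemma fair_run_fair_trs:
  assumes "infinite (UNIV :: 'v set)" "left_linear (pm B)"
    and run: "run (IA_step B gt) E S n" "S n = ({}, R)" and fair: "fair_run B S n"
  shows "fair_trs B gt R"
proof unfold_locales
  show "left_linear R" using fair run(2) by (simp add: fair_run_def)
  have "PCP R \<subseteq> join_mod R B \<union> (\<Union>i \<le> n. sstep (fst (S i) \<union> snd (S i)))"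
    using fair run(2) by (simp add: fair_run_def)
  then show "PCP R \<subseteq> bounded_conv"
    using IA_run_sstep_bounded[OF run] join_mod_bounded by blast
  have "PCPpm R (pm B) \<subseteq> join_mod R B \<union> (\<Union>i \<le> n. sstep (snd (S i)))"
    using fair run(2) by (simp add: fair_run_def)
  then show "PCPpm R (pm B) \<subseteq> cliff_conv"
    using IA_run_sstep_descending[OF run] by blast
qed (fact assms)+

end

theorem fair_run_church_rosser:
  fixes B :: "('f, 'v) trs"
  assumes "infinite (UNIV :: 'v set)" "reduction_order_mod B gt"
    and "left_linear (pm B)"
    and run: "run (IA_step B gt) E S n" "S n = ({}, R)" and fair: "fair_run B S n"
  shows "conv (R \<union> B) \<subseteq> join_mod R B" "E \<subseteq> conv (R \<union> B)"
proof -
  interpret reduction_order_modulo B gt using assms(2) by unfold_locales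
  interpret oriented_trs B gt R
    using IA_run_gt[OF run(1), of n] run(2) by unfold_locales simp
  interpret fair_trs B gt R using fair_run_fair_trs assms by blast
  show "conv (R \<union> B) \<subseteq> join_mod R B" by (rule church_rosser)
  show "E \<subseteq> conv (R \<union> B)"
    using IA_run_bounded[OF run, of 0] run_start[OF run(1)] bounded_conv_subset_conv by auto
qed

section \<open>Simulation by AC completion\<close>

text \<open>Unlike in the transitive closure of \<open>relmod R B\<close>, a single step must end exactly, not only
  modulo \<open>B\<close>, in the contractum: Deduce adds the contractum itself, which Simplify cannot exchange
  for an equivalent term.\<close>

definition reducts :: "('f, 'v) trs \<Rightarrow> ('f, 'v) trs \<Rightarrow> ('f, 'v) term rel" where
  "reducts R B = conv B O rstep R O (relmod R B)\<^sup>*"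

definition siblings :: "('f, 'v) trs \<Rightarrow> ('f, 'v) trs \<Rightarrow> ('f, 'v) trs" where
  "siblings R B = (reducts R B)\<inverse> O reducts R B"

definition valley :: "('f, 'v) trs \<Rightarrow> ('f, 'v) trs \<Rightarrow> ('f, 'v) term rel" where
  "valley R B = (relmod R B)\<^sup>* O conv B O ((relmod R B)\<inverse>)\<^sup>*"

definition simplification :: "('f, 'v) trs \<Rightarrow> ('f, 'v) trs \<Rightarrow> ('f, 'v) rule rel" where
  "simplification R B =
    {(e, (u, t)) | e s t u. (e = (s, t) \<or> e = (t, s)) \<and> (s, u) \<in> relmod R B}"

lemma reductsI:
  "(s, s') \<in> conv B \<Longrightarrow> (s', t') \<in> rstep R \<Longrightarrow> (t', t) \<in> (relmod R B)\<^sup>* \<Longrightarrow> (s, t) \<in> reducts R B"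
  unfolding reducts_def by blast

lemma reductsE:
  assumes "(s, t) \<in> reducts R B"
  obtains s' t' where "(s, s') \<in> conv B" "(s', t') \<in> rstep R" "(t', t) \<in> (relmod R B)\<^sup>*"
  using assms unfolding reducts_def by blast

lemma stable_reducts: "stable (reducts R B)"
  unfolding reducts_def
  by (intro stable_relcomp stable_conv stable_rstep stable_rtrancl stable_relmod)

lemma rstep_reducts: "(s, t) \<in> rstep R \<Longrightarrow> (s, t) \<in> reducts R B"
  by (rule reductsI) auto

lemma conv_reducts: "(s, t) \<in> conv B \<Longrightarrow> (t, u) \<in> reducts R B \<Longrightarrow> (s, u) \<in> reducts R B"
  by (elim reductsE) (rule reductsI, rule conv_trans)

lemma reducts_relmod: "(s, t) \<in> reducts R B \<Longrightarrow> (t, u) \<in> (relmod R B)\<^sup>* \<Longrightarrow> (s, u) \<in> reducts R B"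
  by (elim reductsE) (rule reductsI, assumption+, rule rtrancl_trans)

lemma reducts_mono: "R \<subseteq> R' \<Longrightarrow> reducts R B \<subseteq> reducts R' B"
  unfolding reducts_def by (intro relcomp_mono rstep_mono rtrancl_mono relmod_mono order_refl)

lemma siblingsI: "(u, s) \<in> reducts R B \<Longrightarrow> (u, t) \<in> reducts R B \<Longrightarrow> (s, t) \<in> siblings R B"
  unfolding siblings_def by blast

lemma siblingsE:
  assumes "(s, t) \<in> siblings R B"
  obtains u where "(u, s) \<in> reducts R B" "(u, t) \<in> reducts R B"
  using assms unfolding siblings_def by blast

lemma siblings_sym: "(s, t) \<in> siblings R B \<Longrightarrow> (t, s) \<in> siblings R B"
  by (elim siblingsE) (rule siblingsI)

lemma siblings_mono: "R \<subseteq> R' \<Longrightarrow> siblings R B \<subseteq> siblings R' B"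
  unfolding siblings_def by (intro relcomp_mono converse_mono[THEN iffD2] reducts_mono)

lemma valleyE:
  assumes "(s, t) \<in> valley R B"
  obtains s' t' where "(s, s') \<in> (relmod R B)\<^sup>*" "(s', t') \<in> conv B" "(t, t') \<in> (relmod R B)\<^sup>*"
  using assms unfolding valley_def rtrancl_converse by blast

lemma reducts_trancl: "reducts R B \<subseteq> (relmod R B)\<^sup>+"
proof clarify
  fix s t assume "(s, t) \<in> reducts R B"
  then obtain s' t' where "(s, s') \<in> conv B" "(s', t') \<in> rstep R" "(t', t) \<in> (relmod R B)\<^sup>*"
    by (rule reductsE)
  then have "(s, t') \<in> relmod R B" "(t', t) \<in> (relmod R B)\<^sup>*" by (auto intro: relmodI)
  then show "(s, t) \<in> (relmod R B)\<^sup>+" by (rule rtrancl_into_trancl2)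
qed

lemma reducts_rtrancl: "reducts R B \<subseteq> (relmod R B)\<^sup>*"
  using reducts_trancl[of R B] by (auto simp: rtrancl_eq_or_trancl)

lemma rstep_simulation: "R \<subseteq> reducts R' B \<Longrightarrow> rstep R \<subseteq> reducts R' B"
  by (rule rstep_least[OF stable_reducts])

lemma relmod_simulation:
  assumes "R \<subseteq> reducts R' B" "(s, t) \<in> relmod R B"
  shows "(s, t) \<in> (relmod R' B)\<^sup>+"
proof -
  obtain s' t' where decomposition: "(s, s') \<in> conv B" "(s', t') \<in> rstep R" "(t', t) \<in> conv B"
    using assms(2) by (rule relmodE)
  have "(s, t') \<in> reducts R' B"
    using conv_reducts[OF decomposition(1)] decomposition(2) rstep_simulation[OF assms(1)] by blast
  then have "(s, t') \<in> (relmod R' B)\<^sup>+" using reducts_trancl by blast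
  then obtain v where "(s, v) \<in> (relmod R' B)\<^sup>*" "(v, t') \<in> relmod R' B" by (meson tranclD2)
  then show ?thesis using relmod_conv[OF _ decomposition(3)] by (meson rtrancl_into_trancl1)
qed

lemma join_mod_simulation:
  assumes "R \<subseteq> reducts R' B"
  shows "join_mod R B \<subseteq> valley R' B"
proof -
  have "rstep R \<subseteq> (relmod R' B)\<^sup>*"
    using rstep_simulation[OF assms] reducts_rtrancl by (rule order_trans)
  then have "(rstep R)\<^sup>* \<subseteq> (relmod R' B)\<^sup>*" by (rule rtrancl_subset_rtrancl)
  then show ?thesis unfolding join_mod_def valley_def rtrancl_converse by blast
qed

lemma conv_simulation:
  assumes "R \<subseteq> reducts R' B"
  shows "conv (R \<union> B) \<subseteq> conv (R' \<union> B)"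
proof (rule conv_least)
  have "relmod R' B \<subseteq> conv (R' \<union> B)"
    using subset_conv[of "R' \<union> B"] by (intro relmod_subset_conv) auto
  then have "(relmod R' B)\<^sup>* \<subseteq> conv (R' \<union> B)"
    unfolding conv_def by (rule rtrancl_subset_rtrancl)
  then show "R \<union> B \<subseteq> conv (R' \<union> B)"
    using assms reducts_rtrancl[of R' B] subset_conv[of "R' \<union> B"] by blast
qed

lemma simulation_conv_eq:
  assumes "E \<subseteq> conv (R \<union> B)" "R \<subseteq> reducts R' B" "R' \<subseteq> conv (E \<union> B)"
  shows "conv (R \<union> B) = conv (E \<union> B)" "conv (R' \<union> B) = conv (E \<union> B)"
proof -
  have "conv (E \<union> B) \<subseteq> conv (R \<union> B)"
    using assms(1) subset_conv[of "R \<union> B"] by (intro conv_least) blast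
  moreover have "conv (R \<union> B) \<subseteq> conv (R' \<union> B)" using assms(2) by (rule conv_simulation)
  moreover have "conv (R' \<union> B) \<subseteq> conv (E \<union> B)"
    using assms(3) subset_conv[of "E \<union> B"] by (intro conv_least) blast
  ultimately show "conv (R \<union> B) = conv (E \<union> B)" "conv (R' \<union> B) = conv (E \<union> B)" by auto
qed

lemma siblings_simplification:
  assumes "(e, e') \<in> simplification R B" "e \<in> siblings R B"
  shows "e' \<in> siblings R B"
proof -
  obtain s t u where orientation: "e = (s, t) \<or> e = (t, s)" "e' = (u, t)"
    and rewrite: "(s, u) \<in> relmod R B"
    using assms(1) by (auto simp: simplification_def)
  have "(s, t) \<in> siblings R B" using orientation(1) assms(2) siblings_sym by blast
  then obtain v where "(v, s) \<in> reducts R B" "(v, t) \<in> reducts R B" by (rule siblingsE)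
  then show ?thesis unfolding orientation(2) using rewrite by (auto intro: siblingsI reducts_relmod)
qed

lemma siblings_simplification_rtrancl:
  "(e, e') \<in> (simplification R B)\<^sup>* \<Longrightarrow> e \<in> siblings R B \<Longrightarrow> e' \<in> siblings R B"
  by (induction rule: rtrancl_induct) (auto intro: siblings_simplification)

lemma simplification_relmod_rtrancl:
  "(s, u) \<in> (relmod R B)\<^sup>* \<Longrightarrow> ((s, t), (u, t)) \<in> (simplification R B)\<^sup>*"
  by (erule rtrancl_map[where f = "\<lambda>s. (s, t)"]) (auto simp: simplification_def)

lemma simplification_relmod_trancl:
  assumes "(s, u) \<in> (relmod R B)\<^sup>+" "e = (s, t) \<or> e = (t, s)"
  shows "(e, (u, t)) \<in> (simplification R B)\<^sup>*"
proof -
  obtain v where first_step: "(s, v) \<in> relmod R B" "(v, u) \<in> (relmod R B)\<^sup>*"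
    using assms(1) by (meson tranclD)
  have "(e, (v, t)) \<in> simplification R B"
    using first_step(1) assms(2) by (auto simp: simplification_def)
  then show ?thesis
    using simplification_relmod_rtrancl[OF first_step(2)] by (rule converse_rtrancl_into_rtrancl)
qed

lemma simplification_both_sides:
  assumes "(s, s') \<in> (relmod R B)\<^sup>*" "(t, t') \<in> (relmod R B)\<^sup>*"
  obtains e where "e = (s', t') \<or> e = (t', s')" "((s, t), e) \<in> (simplification R B)\<^sup>*"
proof (cases "t = t'")
  case True
  then show thesis using that simplification_relmod_rtrancl[OF assms(1)] by blast
next
  case False
  then have "(t, t') \<in> (relmod R B)\<^sup>+" using assms(2) by (simp add: rtrancl_eq_or_trancl)
  then have "((s', t), (t', s')) \<in> (simplification R B)\<^sup>*"
    by (rule simplification_relmod_trancl) simp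
  with simplification_relmod_rtrancl[OF assms(1)]
  have "((s, t), (t', s')) \<in> (simplification R B)\<^sup>*" by (rule rtrancl_trans)
  then show thesis by (rule that[rotated]) simp
qed

abbreviation KBAC_steps ::
  "'f set \<Rightarrow> ('f, 'v) term rel \<Rightarrow> ('f, 'v) state \<Rightarrow> ('f, 'v) state \<Rightarrow> bool" where
  "KBAC_steps F gt \<equiv> (KBAC_step F gt)\<^sup>*\<^sup>*"

text \<open>States are sets, so simplifying \<open>e\<close> to an equation \<open>d\<close> that is already present merges the two.
  In that case \<open>d\<close> is first moved on to \<open>e'\<close>, and \<open>e\<close> then takes its place.\<close>

lemma KBAC_simplify_rtrancl:
  assumes "(e, e') \<in> (simplification R (AC F))\<^sup>*" "e \<in> E"
  shows "KBAC_steps F gt (E, R) (E - {e} \<union> {e'}, R)"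
  using assms
proof (induction arbitrary: E rule: converse_rtrancl_induct)
  case base
  then have "E - {e'} \<union> {e'} = E" by blast
  then show ?case by simp
next
  case (step e d)
  obtain s t u where "e = (s, t) \<or> e = (t, s)" "d = (u, t)" "(s, u) \<in> relmod R (AC F)"
    using step.hyps(1) by (auto simp: simplification_def)
  then have simplify: "KBAC_step F gt (D, R) (D - {e} \<union> {d}, R)" if "e \<in> D" for D
    using KBAC_step.simplify[OF that] by blast
  consider (unchanged) "e = e'" | (loop) "e = d" | (fresh) "d \<notin> E"
    | (merge) "d \<in> E" "e \<noteq> d" "e \<noteq> e'" by blast
  then show ?case
  proof cases
    case unchanged
    then have "E - {e} \<union> {e'} = E" using step.prems by blast
    then show ?thesis by simp
  next
    case loop
    then show ?thesis using step by blast
  next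
    case fresh
    have "KBAC_steps F gt (E - {e} \<union> {d}, R) (E - {e} \<union> {d} - {d} \<union> {e'}, R)"
      by (rule step.IH) simp
    moreover have "E - {e} \<union> {d} - {d} \<union> {e'} = E - {e} \<union> {e'}" using fresh by blast
    ultimately show ?thesis
      using simplify[OF step.prems] by (simp add: converse_rtranclp_into_rtranclp)
  next
    case merge
    have "KBAC_steps F gt (E, R) (E - {d} \<union> {e'}, R)" using merge(1) by (rule step.IH)
    moreover have "KBAC_step F gt (E - {d} \<union> {e'}, R) (E - {d} \<union> {e'} - {e} \<union> {d}, R)"
      using merge step.prems by (intro simplify) blast
    moreover have "E - {d} \<union> {e'} - {e} \<union> {d} = E - {e} \<union> {e'}" using merge by blast
    ultimately show ?thesis by simp
  qed
qed

lemma KBAC_orient_sibling: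
  assumes "(s, t) \<in> siblings R (AC F)" "(s, t) \<in> gt"
  shows "\<exists>E'. KBAC_steps F gt (E, R) (E', R \<union> {(s, t)}) \<and> E \<subseteq> E' \<union> siblings R (AC F)"
proof -
  obtain w where "(w, s) \<in> reducts R (AC F)" "(w, t) \<in> reducts R (AC F)"
    using assms(1) by (rule siblingsE)
  then obtain a b c d where
    left: "(w, a) \<in> conv (AC F)" "(a, b) \<in> rstep R" "(b, s) \<in> (relmod R (AC F))\<^sup>*" and
    right: "(w, c) \<in> conv (AC F)" "(c, d) \<in> rstep R" "(d, t) \<in> (relmod R (AC F))\<^sup>*"
    by (elim reductsE)
  have "(a, c) \<in> conv (AC F)" using conv_trans[OF conv_sym[OF left(1)] right(1)] .
  then have deduce: "KBAC_step F gt (E, R) (E \<union> {(b, d)}, R)"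
    using left(2) right(2) by (intro KBAC_step.deduce) blast
  have peak_sibling: "(b, d) \<in> siblings R (AC F)"
    using reductsI[OF left(1,2) rtrancl.rtrancl_refl] reductsI[OF right(1,2) rtrancl.rtrancl_refl]
    by (rule siblingsI)
  obtain e where simplified: "e = (s, t) \<or> e = (t, s)" "((b, d), e) \<in> (simplification R (AC F))\<^sup>*"
    using left(3) right(3) by (rule simplification_both_sides)
  let ?D = "E \<union> {(b, d)} - {(b, d)} \<union> {e}"
  have "KBAC_steps F gt (E \<union> {(b, d)}, R) (?D, R)"
    using simplified(2) by (rule KBAC_simplify_rtrancl) simp
  moreover have "KBAC_step F gt (?D, R) (?D - {e}, R \<union> {(s, t)})"
    using simplified(1) assms(2) by (intro KBAC_step.orient) auto
  ultimately have "KBAC_steps F gt (E, R) (?D - {e}, R \<union> {(s, t)})"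
    using deduce by (meson converse_rtranclp_into_rtranclp rtranclp.rtrancl_into_rtrancl)
  moreover have "E \<subseteq> ?D - {e} \<union> siblings R (AC F)"
    using peak_sibling siblings_simplification_rtrancl[OF simplified(2) peak_sibling] by blast
  ultimately show ?thesis by blast
qed

text \<open>The simulating run never removes rules. Equations that are siblings can be deduced again at
  any time, so only the others have to be kept.\<close>

definition simulates :: "('f, 'v) trs \<Rightarrow> ('f, 'v) state \<Rightarrow> ('f, 'v) state \<Rightarrow> bool" where
  "simulates B S' S \<longleftrightarrow>
    snd S \<subseteq> reducts (snd S') B \<and> fst S \<subseteq> fst S' \<union> siblings (snd S') B"

lemma simulates_refl: "simulates B S S"
  unfolding simulates_def using rstep_reducts[OF rstep_rule] by fast

lemma simulation_orient:
  assumes simulated: "simulates (AC F) (E', R') (E, R)"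
    and equation: "e \<in> E" "e = (s, t) \<or> e = (t, s)" and decrease: "(s, t) \<in> gt"
  shows "\<exists>S'. KBAC_steps F gt (E', R') S' \<and> simulates (AC F) S' (E - {e}, R \<union> {(s, t)})"
proof -
  let ?R = "R' \<union> {(s, t)}"
  have "\<exists>E2. KBAC_steps F gt (E', R') (E2, ?R) \<and> E' \<subseteq> E2 \<union> {e} \<union> siblings R' (AC F)"
  proof (cases "e \<in> siblings R' (AC F)")
    case True
    then have "(s, t) \<in> siblings R' (AC F)" using equation(2) siblings_sym by blast
    from KBAC_orient_sibling[OF this decrease, of E'] show ?thesis by blast
  next
    case False
    then have "e \<in> E'" using simulated equation(1) by (auto simp: simulates_def)
    from KBAC_step.orient[OF this equation(2) decrease, of F R'] show ?thesis by blast
  qed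
  then obtain E2 where
    oriented: "KBAC_steps F gt (E', R') (E2, ?R)" "E' \<subseteq> E2 \<union> {e} \<union> siblings R' (AC F)" by blast
  have "(s, t) \<in> reducts ?R (AC F)" by (intro rstep_reducts rstep_rule) simp
  moreover have "siblings R' (AC F) \<subseteq> siblings ?R (AC F)" "reducts R' (AC F) \<subseteq> reducts ?R (AC F)"
    by (intro siblings_mono reducts_mono Un_upper1)+
  ultimately have "simulates (AC F) (E2, ?R) (E - {e}, R \<union> {(s, t)})"
    using simulated oriented(2) unfolding simulates_def fst_conv snd_conv by blast
  with oriented(1) show ?thesis by blast
qed

lemma simulation_simplify:
  assumes simulated: "simulates (AC F) (E', R') (E, R)"
    and equation: "e \<in> E" "e = (s, t) \<or> e = (t, s)" and rewrite: "(s, u) \<in> relmod R (AC F)"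
  shows "\<exists>S'. KBAC_steps F gt (E', R') S' \<and> simulates (AC F) S' (E - {e} \<union> {(u, t)}, R)"
proof -
  have "(s, u) \<in> (relmod R' (AC F))\<^sup>+"
    using simulated rewrite by (intro relmod_simulation[of R]) (auto simp: simulates_def)
  then have path: "(e, (u, t)) \<in> (simplification R' (AC F))\<^sup>*"
    using equation(2) by (rule simplification_relmod_trancl)
  show ?thesis
  proof (cases "e \<in> siblings R' (AC F)")
    case True
    with path have "(u, t) \<in> siblings R' (AC F)" by (rule siblings_simplification_rtrancl)
    then have "simulates (AC F) (E', R') (E - {e} \<union> {(u, t)}, R)"
      using simulated by (auto simp: simulates_def)
    then show ?thesis by blast
  next
    case False
    then have "e \<in> E'" using simulated equation(1) by (auto simp: simulates_def)
    with path have "KBAC_steps F gt (E', R') (E' - {e} \<union> {(u, t)}, R')"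
      by (rule KBAC_simplify_rtrancl)
    moreover have "simulates (AC F) (E' - {e} \<union> {(u, t)}, R') (E - {e} \<union> {(u, t)}, R)"
      using simulated by (auto simp: simulates_def)
    ultimately show ?thesis by blast
  qed
qed

lemma simulation_stutter:
  assumes "simulates (AC F) S' (E, R)"
    and "E2 \<subseteq> E \<union> siblings (snd S') (AC F)" "R2 \<subseteq> reducts (snd S') (AC F)"
  shows "\<exists>T'. KBAC_steps F gt S' T' \<and> simulates (AC F) T' (E2, R2)"
proof (intro exI conjI)
  show "KBAC_steps F gt S' S'" by simp
  show "simulates (AC F) S' (E2, R2)" using assms by (auto simp: simulates_def)
qed

lemma IA_step_simulation:
  assumes "IA_step (AC F) gt S T" "simulates (AC F) S' S"
  shows "\<exists>T'. KBAC_steps F gt S' T' \<and> simulates (AC F) T' T"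
proof -
  let ?reducts = "reducts (snd S') (AC F)" and ?siblings = "siblings (snd S') (AC F)"
  have rules: "snd S \<subseteq> ?reducts" using assms(2) by (simp add: simulates_def)
  then have steps: "rstep (snd S) \<subseteq> ?reducts" by (rule rstep_simulation)
  from assms(1,2) rules steps show ?thesis
  proof (induction rule: IA_step.induct)
    case (deduce_peak s t R E)
    then have "(s, t) \<in> ?siblings" by (auto intro: siblingsI)
    then show ?case using deduce_peak.prems by (intro simulation_stutter[of F S' E R]) auto
  next
    case (deduce_cliff s t R E)
    then obtain u where "(u, s) \<in> rstep R" "(u, t) \<in> sstep (AC F)" by blast
    then have "(t, u) \<in> conv (AC F)" "(u, s) \<in> ?reducts"
      using deduce_cliff.prems(3) conv_sym[OF sstep_conv] by auto
    then have "(t, s) \<in> ?reducts" by (rule conv_reducts)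
    then show ?case using deduce_cliff.prems by (intro simulation_stutter[of F S' E R]) auto
  next
    case (orient e E s t R)
    then show ?case using simulation_orient[of F "fst S'" "snd S'" E R e s t gt] by simp
  next
    case (delete s t E R)
    then show ?case by (intro simulation_stutter[of F S' E R]) auto
  next
    case (simplify e E s t u R)
    then show ?case using simulation_simplify[of F "fst S'" "snd S'" E R e s t u gt] by simp
  next
    case (collapse s t R u E)
    then have "(s, u) \<in> ?reducts" "(s, t) \<in> ?reducts"
      using rstep_mono[of "R - {(s, t)}" R] by auto
    then have "(u, t) \<in> ?siblings" by (rule siblingsI)
    then show ?case using collapse.prems by (intro simulation_stutter[of F S' E R]) auto
  next
    case (compose s t R u E)
    then have "(s, t) \<in> ?reducts" "(t, u) \<in> relmod R (AC F)"
      using relmod_mono[of "R - {(s, t)}" R] by auto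
    moreover have "R \<subseteq> ?reducts" using compose.prems(2) by simp
    ultimately have "(s, u) \<in> ?reducts"
      using relmod_simulation reducts_relmod trancl_into_rtrancl by metis
    then show ?case using compose.prems by (intro simulation_stutter[of F S' E R]) auto
  qed
qed

lemma IA_steps_simulation:
  "(IA_step (AC F) gt)\<^sup>*\<^sup>* S T \<Longrightarrow> \<exists>T'. KBAC_steps F gt S T' \<and> simulates (AC F) T' T"
proof (induction rule: rtranclp_induct)
  case base
  show ?case by (rule exI[of _ S]) (simp add: simulates_refl)
next
  case (step T U)
  from step.IH obtain T' where simulated: "KBAC_steps F gt S T'" "simulates (AC F) T' T" by blast
  from IA_step_simulation[OF step.hyps(2) simulated(2)] obtain U' where
    next_simulated: "KBAC_steps F gt T' U'" "simulates (AC F) U' U" by blast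
  have "KBAC_steps F gt S U'" using simulated(1) next_simulated(1) by (rule rtranclp_trans)
  with next_simulated(2) show ?case by blast
qed

lemma KBAC_discharge:
  assumes "finite E" "E \<subseteq> valley R (AC F)"
  shows "KBAC_steps F gt (E, R) ({}, R)"
  using assms
proof (induction E rule: finite_psubset_induct)
  case (psubset E)
  show ?case
  proof (cases "E = {}")
    case False
    then obtain s t where equation: "(s, t) \<in> E" by auto
    then have "(s, t) \<in> valley R (AC F)" using psubset.prems by blast
    then obtain s' t' where valley: "(s, s') \<in> (relmod R (AC F))\<^sup>*" "(s', t') \<in> conv (AC F)"
      "(t, t') \<in> (relmod R (AC F))\<^sup>*" by (rule valleyE)
    obtain e where simplified: "e = (s', t') \<or> e = (t', s')"
      "((s, t), e) \<in> (simplification R (AC F))\<^sup>*"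
      using valley(1,3) by (rule simplification_both_sides)
    then obtain v w where deletable: "e = (v, w)" "(v, w) \<in> conv (AC F)"
      using valley(2) conv_sym[OF valley(2)] by blast
    let ?D = "E - {(s, t)} \<union> {e}"
    have "KBAC_steps F gt (E, R) (?D, R)"
      using simplified(2) equation by (rule KBAC_simplify_rtrancl)
    also have "KBAC_step F gt (?D, R) (?D - {e}, R)"
      unfolding deletable(1) using deletable(2) by (intro KBAC_step.delete) simp
    also have "KBAC_steps F gt (?D - {e}, R) ({}, R)"
      using psubset.prems equation by (intro psubset.IH) auto
    finally show ?thesis .
  qed simp
qed

lemma IA_step_finite: "IA_step B gt S T \<Longrightarrow> finite (fst T) \<Longrightarrow> finite (fst S)"
  by (induction rule: IA_step.induct) auto

lemma IA_steps_finite: "(IA_step B gt)\<^sup>*\<^sup>* S T \<Longrightarrow> finite (fst T) \<Longrightarrow> finite (fst S)"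
  by (induction rule: rtranclp_induct) (auto intro: IA_step_finite)

lemma KBAC_step_finite: "KBAC_step F gt S T \<Longrightarrow> finite (fst S) \<Longrightarrow> finite (fst T)"
  by (induction rule: KBAC_step.induct) auto

lemma KBAC_steps_finite: "KBAC_steps F gt S T \<Longrightarrow> finite (fst S) \<Longrightarrow> finite (fst T)"
  by (induction rule: rtranclp_induct) (auto intro: KBAC_step_finite)

lemma KBAC_step_sound:
  assumes "KBAC_step F gt S T" "AC F \<subseteq> conv X" "fst S \<union> snd S \<subseteq> conv X"
  shows "fst T \<union> snd T \<subseteq> conv X"
  using assms
proof (induction rule: KBAC_step.induct)
  case (deduce s t R E)
  have "rstep R \<subseteq> conv X" using deduce.prems by (intro rstep_least[OF stable_conv]) simp
  moreover have "conv (AC F) \<subseteq> conv X" using deduce.prems(1) by (rule conv_least)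
  ultimately obtain u v where "(u, s) \<in> conv X" "(u, v) \<in> conv X" "(v, t) \<in> conv X"
    using deduce.hyps by blast
  then have "(s, t) \<in> conv X" by (rule conv_trans[OF conv_trans[OF conv_sym]])
  then show ?case using deduce.prems by simp
next
  case (orient e E s t R)
  then have "(s, t) \<in> conv X" using conv_sym[of t s] by auto
  then show ?case using orient.prems by auto
next
  case (delete s t E R)
  then show ?case by auto
next
  case (simplify e E s t u R)
  then have "(s, t) \<in> conv X" "(s, u) \<in> conv X"
    using relmod_subset_conv[of R X "AC F"] conv_sym[of t s] by auto
  then have "(u, t) \<in> conv X" by (rule conv_trans[OF conv_sym, rotated])
  then show ?case using simplify.prems by auto
next
  case (collapse s t R u E)
  then have "(s, t) \<in> conv X" "(s, u) \<in> conv X"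
    using relmod_subset_conv[of "R - {(s, t)}" X "AC F"] by auto
  then have "(u, t) \<in> conv X" by (rule conv_trans[OF conv_sym, rotated])
  then show ?case using collapse.prems by auto
next
  case (compose s t R u E)
  then have "(s, t) \<in> conv X" "(t, u) \<in> conv X"
    using relmod_subset_conv[of "R - {(s, t)}" X "AC F"] by auto
  then have "(s, u) \<in> conv X" by (rule conv_trans)
  then show ?case using compose.prems by auto
qed

lemma KBAC_steps_sound:
  "KBAC_steps F gt S T \<Longrightarrow> AC F \<subseteq> conv X \<Longrightarrow> fst S \<union> snd S \<subseteq> conv X \<Longrightarrow> fst T \<union> snd T \<subseteq> conv X"
  by (induction rule: rtranclp_induct) (auto dest: KBAC_step_sound)

lemma KBAC_step_gt:
  assumes "KBAC_step F gt S T" "reduction_order_mod (AC F) gt" "snd S \<subseteq> gt"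
  shows "snd T \<subseteq> gt"
proof -
  interpret reduction_order_modulo "AC F" gt using assms(2) by unfold_locales
  from assms(1,3) show ?thesis
  proof (induction rule: KBAC_step.induct)
    case (compose s t R u E)
    then have "(s, t) \<in> gt" "(t, u) \<in> gt" using relmod_gt[of "R - {(s, t)}"] by auto
    then show ?case using compose.prems gt_trans by auto
  qed auto
qed

lemma KBAC_steps_gt:
  "KBAC_steps F gt S T \<Longrightarrow> reduction_order_mod (AC F) gt \<Longrightarrow> snd S \<subseteq> gt \<Longrightarrow> snd T \<subseteq> gt"
  by (induction rule: rtranclp_induct) (auto dest: KBAC_step_gt)

lemma left_linear_pm_AC: "left_linear (pm (AC F))"
  by (auto simp: left_linear_def pm_def AC_def linear_term_def)

theorem theorem7p5:
  fixes F :: "'f set" and gt :: "('f, 'v) term rel"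
    and E R :: "('f, 'v) trs" and S :: "nat \<Rightarrow> ('f, 'v) state" and n :: nat
  assumes "infinite (UNIV :: 'v set)"
    and "reduction_order_mod (AC F) gt"
    and "run (IA_step (AC F) gt) E S n"
    and "S n = ({}, R)"
    and "fair_run (AC F) S n"
  shows "\<exists>S' m R'. run (KBAC_step F gt) E S' m \<and> S' m = ({}, R') \<and>
           SN_rel (relmod R' (AC F)) \<and>
           conv (E \<union> AC F) = conv (R' \<union> AC F) \<and>
           conv (R' \<union> AC F) \<subseteq>
             (relmod R' (AC F))\<^sup>* O conv (AC F) O ((relmod R' (AC F))\<inverse>)\<^sup>*"
proof -
  note church_rosser = fair_run_church_rosser[OF assms(1,2) left_linear_pm_AC assms(3-5)]
  have IA_steps: "(IA_step (AC F) gt)\<^sup>*\<^sup>* (E, {}) ({}, R)"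
    using run_iff_rtranclp assms(3,4) by metis
  then obtain E' R' where KBAC_steps: "KBAC_steps F gt (E, {}) (E', R')"
    and "simulates (AC F) (E', R') ({}, R)"
    using IA_steps_simulation by (metis surj_pair)
  then have simulated: "R \<subseteq> reducts R' (AC F)" by (simp add: simulates_def)
  have sound: "E' \<union> R' \<subseteq> conv (E \<union> AC F)"
    using KBAC_steps_sound[OF KBAC_steps] subset_conv[of "E \<union> AC F"] by simp
  then have conv_eq: "conv (R \<union> AC F) = conv (E \<union> AC F)" "conv (R' \<union> AC F) = conv (E \<union> AC F)"
    using simulation_conv_eq[OF church_rosser(2) simulated] by auto
  then have valley: "conv (E \<union> AC F) \<subseteq> valley R' (AC F)"
    using church_rosser(1) join_mod_simulation[OF simulated] by simp
  have "finite E'" using KBAC_steps_finite[OF KBAC_steps] IA_steps_finite[OF IA_steps] by simp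
  then have "KBAC_steps F gt (E', R') ({}, R')" using sound valley by (intro KBAC_discharge) auto
  with KBAC_steps have "KBAC_steps F gt (E, {}) ({}, R')" by (rule rtranclp_trans)
  then obtain S' m where "run (KBAC_step F gt) E S' m" "S' m = ({}, R')"
    using run_iff_rtranclp by metis
  moreover have "SN_rel (relmod R' (AC F))"
    using KBAC_steps_gt[OF KBAC_steps assms(2)] reduction_order_modulo.SN_relmod
      reduction_order_modulo.intro[OF assms(2)] by simp
  ultimately show ?thesis using conv_eq valley unfolding valley_def by blast
qed

end
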